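(* Let $X$ and $Y$ be two Köthe sequence spaces with the Fatou property. Suppose that either the space $X$ is reflexive or the space $Y$ is separable. Then for every $\lambda=\{\lambda_n\}_{n=1}^\infty\in M(X,Y)$ $$\|M_\lambda\colon X\to Y\|_{ess}=\lim_{n\to\infty}\Big\|\sum_{i=n}^\infty\lambda_ie_i\Big\|_{M(X,Y)}.$$ In particular, the multiplication operator $M_\lambda\colon X\to Y$ is compact if, and only if, $\lambda\in M(X,Y)_o$.
   Context: A Köthe space on a complete $\sigma$-finite measure space $(\Omega,\Sigma,\mu)$ is a Banach space $X$ which is a linear subspace of $L_0(\Omega)$ (a.e.-equivalence classes of real or complex measurable functions integrable over sets of finite measure), such that if $|f|\le|g|$ a.e. with $f$ measurable and $g\in X$, then $f\in X$ and $\|f\|_X\le\|g\|_X$, and such that $\chi_A\in X$ whenever $\mu(A)<\infty$. A Köthe sequence space is a Köthe space over a purely atomic measure space; its elements are identified with sequences $x=\{x_n\}_{n=1}^\infty$, $e_i$ is the $i$-th unit vector, and $\sum_{i=n}^\infty\lambda_ie_i$ denotes the sequence $\lambda\chi_{\{n,n+1,\dots\}}$. $X$ and $Y$ are defined over the same measure space. $X$ has the Fatou property if its closed unit ball is closed in $L_0$ for the topology of local convergence in measure. In the paper, separability of a Köthe space is used interchangeably with order continuity ($X=X_o$). $M(X,Y)=\{g: fg\in Y\text{ for all }f\in X\}$ (pointwise products) with norm $\|g\|_{M(X,Y)}=\sup_{\|f\|_X\le1}\|fg\|_Y$; $M_\lambda f=\lambda f$. $\|T\colon X\to Y\|_{ess}=\inf\{\|T-K\|_{X\to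 Y}:K\colon X\to Y\text{ compact}\}$. For a Köthe space $Z$, $Z_o$ is the set of order continuous elements: those $f\in Z$ such that $\|f_n\|_Z\to0$ for every sequence $(f_n)$ in $Z$ with $0\le f_n\le|f|$ and $f_n\downarrow0$ pointwise. *)

theory Defs
  imports "HOL-Analysis.Analysis"
begin

text \<open>
  Scalars. Every type of class real_normed_field is isometrically isomorphic to the real or to the
  complex numbers, and both of these are instances of the sort used below. The type variable 'k
  therefore stands for exactly the two usual choices of scalar field.

  Elements of function spaces are represented by functions instead of a.e.-equivalence classes.
  Hence a norm on a Koethe space over a general measure space vanishes exactly on the functions that
  are zero a.e. Over the measure spaces of the locale \<open>kothe_sequence_measure\<close> below, a.e. equality
  is equality, and the elements are just sequences.
\<close>

definition L0 :: "'a measure \<Rightarrow> ('a \<Rightarrow> 'k::{real_normed_field, euclidean_space}) set" where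
  "L0 M = {f \<in> borel_measurable M. \<forall>A\<in>sets M. emeasure M A < \<infinity> \<longrightarrow> set_integrable M A f}"

text \<open>
  The norm is a total function. Its values outside the carrier \<open>X\<close> are irrelevant.
\<close>

locale kothe_space = complete_measure M + sigma_finite_measure M
  for M :: "'a measure" +
  fixes X :: "('a \<Rightarrow> 'k::{real_normed_field, euclidean_space}) set"
    and N :: "('a \<Rightarrow> 'k) \<Rightarrow> real"
  assumes subset_L0: "X \<subseteq> L0 M"
    and zero_mem: "(\<lambda>x. 0) \<in> X"
    and add_mem: "f \<in> X \<Longrightarrow> g \<in> X \<Longrightarrow> (\<lambda>x. f x + g x) \<in> X"
    and scale_mem: "f \<in> X \<Longrightarrow> (\<lambda>x. c * f x) \<in> X"
    and norm_nonneg: "f \<in> X \<Longrightarrow> 0 \<le> N f"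
    and norm_eq_0_iff: "f \<in> X \<Longrightarrow> N f = 0 \<longleftrightarrow> (AE x in M. f x = 0)"
    and norm_triangle: "f \<in> X \<Longrightarrow> g \<in> X \<Longrightarrow> N (\<lambda>x. f x + g x) \<le> N f + N g"
    and norm_scale: "f \<in> X \<Longrightarrow> N (\<lambda>x. c * f x) = norm c * N f"
    and complete:
      "\<lbrakk>\<And>n::nat. F n \<in> X;
        \<forall>e>0. \<exists>n0. \<forall>m\<ge>n0. \<forall>n\<ge>n0. N (\<lambda>x. F m x - F n x) < e\<rbrakk>
       \<Longrightarrow> \<exists>f\<in>X. (\<lambda>n. N (\<lambda>x. F n x - f x)) \<longlonglongrightarrow> 0"
    and ideal_mem:
      "\<lbrakk>f \<in> borel_measurable M; g \<in> X; AE x in M. norm (f x) \<le> norm (g x)\<rbrakk> \<Longrightarrow> f \<in> X"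
    and ideal_norm:
      "\<lbrakk>f \<in> borel_measurable M; g \<in> X; AE x in M. norm (f x) \<le> norm (g x)\<rbrakk> \<Longrightarrow> N f \<le> N g"
    and indicator_mem: "A \<in> sets M \<Longrightarrow> emeasure M A < \<infinity> \<Longrightarrow> indicator A \<in> X"

text \<open>
  A purely atomic sigma-finite measure space with its atoms enumerated by \<^typ>\<open>nat\<close>. An atom of a
  sigma-finite measure has positive finite mass, and measurable functions are a.e. constant on it.
  The masses of different atoms may differ.
\<close>

locale kothe_sequence_measure =
  fixes M :: "nat measure"
  assumes space_eq: "space M = UNIV"
    and sets_eq: "sets M = UNIV"
    and atom_pos: "0 < emeasure M {n}"
    and atom_finite: "emeasure M {n} < \<infinity>"

locale kothe_sequence_space = kothe_sequence_measure M + kothe_space M X N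
  for M :: "nat measure"
    and X :: "(nat \<Rightarrow> 'k::{real_normed_field, euclidean_space}) set"
    and N :: "(nat \<Rightarrow> 'k) \<Rightarrow> real"

definition local_measure_nbhd ::
  "'a measure \<Rightarrow> ('a \<Rightarrow> 'k::{real_normed_field, euclidean_space}) \<Rightarrow> 'a set \<Rightarrow> real \<Rightarrow> ('a \<Rightarrow> 'k) set"
where
  "local_measure_nbhd M f A e = {g \<in> L0 M. measure M {x \<in> A. norm (g x - f x) > e} < e}"

definition local_measure_open ::
  "'a measure \<Rightarrow> ('a \<Rightarrow> 'k::{real_normed_field, euclidean_space}) set \<Rightarrow> bool" where
  "local_measure_open M U \<longleftrightarrow> U \<subseteq> L0 M \<and>
     (\<forall>f\<in>U. \<exists>A\<in>sets M. emeasure M A < \<infinity> \<and> (\<exists>e>0. local_measure_nbhd M f A e \<subseteq> U))"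

definition local_measure_topology ::
  "'a measure \<Rightarrow> ('a \<Rightarrow> 'k::{real_normed_field, euclidean_space}) topology" where
  "local_measure_topology M = topology (local_measure_open M)"

lemma L0_level_set:
  fixes f g :: "'a \<Rightarrow> 'k::{real_normed_field, euclidean_space}"
  assumes "f \<in> L0 M" "g \<in> L0 M" "A \<in> sets M"
  shows "{x \<in> A. norm (g x - f x) > e} \<in> sets M"
proof -
  have [measurable]: "f \<in> borel_measurable M" "g \<in> borel_measurable M" "A \<in> sets M"
    using assms by (auto simp: L0_def)
  have "{x \<in> space M. x \<in> A \<and> norm (g x - f x) > e} \<in> sets M" by measurable
  moreover have "{x \<in> space M. x \<in> A \<and> norm (g x - f x) > e} = {x \<in> A. norm (g x - f x) > e}"
    using sets.sets_into_space[OF assms(3)] by auto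
  ultimately show ?thesis by simp
qed

lemma local_measure_nbhd_mono:
  fixes f :: "'a \<Rightarrow> 'k::{real_normed_field, euclidean_space}"
  assumes f: "f \<in> L0 M" and B: "B \<in> sets M" "emeasure M B < \<infinity>"
    and A: "A \<in> sets M" "A \<subseteq> B" and e: "e' \<le> e"
  shows "local_measure_nbhd M f B e' \<subseteq> local_measure_nbhd M f A e"
proof
  fix g assume g: "g \<in> local_measure_nbhd M f B e'"
  then have gL: "g \<in> L0 M" and m: "measure M {x \<in> B. norm (g x - f x) > e'} < e'"
    by (auto simp: local_measure_nbhd_def)
  have SB: "{x \<in> B. norm (g x - f x) > e'} \<in> sets M"
    by (rule L0_level_set[OF f gL B(1)])
  have "emeasure M {x \<in> B. norm (g x - f x) > e'} \<le> emeasure M B"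
    by (rule emeasure_mono) (use B in auto)
  then have fin: "{x \<in> B. norm (g x - f x) > e'} \<in> fmeasurable M"
    using SB B(2) by (intro fmeasurableI) auto
  have "measure M {x \<in> A. norm (g x - f x) > e} \<le> measure M {x \<in> B. norm (g x - f x) > e'}"
    by (rule measure_mono_fmeasurable[OF _ L0_level_set[OF f gL A(1)] fin])
       (use A(2) e in auto)
  then show "g \<in> local_measure_nbhd M f A e"
    using gL m e by (auto simp: local_measure_nbhd_def)
qed

lemma istopology_local_measure_open:
  "istopology (local_measure_open M :: ('a \<Rightarrow> 'k::{real_normed_field, euclidean_space}) set \<Rightarrow> bool)"
  unfolding istopology_def
proof (intro conjI allI impI)
  fix S T :: "('a \<Rightarrow> 'k) set"
  assume S: "local_measure_open M S" and T: "local_measure_open M T"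
  show "local_measure_open M (S \<inter> T)"
    unfolding local_measure_open_def
  proof (intro conjI ballI)
    show "S \<inter> T \<subseteq> L0 M" using S by (auto simp: local_measure_open_def)
    fix f assume f: "f \<in> S \<inter> T"
    then have fL: "f \<in> L0 M" using S by (auto simp: local_measure_open_def)
    obtain A e where A: "A \<in> sets M" "emeasure M A < \<infinity>" "e > 0" "local_measure_nbhd M f A e \<subseteq> S"
      using S f unfolding local_measure_open_def by blast
    obtain B d where B: "B \<in> sets M" "emeasure M B < \<infinity>" "d > 0" "local_measure_nbhd M f B d \<subseteq> T"
      using T f unfolding local_measure_open_def by blast
    have AB: "A \<union> B \<in> sets M" "emeasure M (A \<union> B) < \<infinity>"
      using A B emeasure_subadditive[OF A(1) B(1)]
      by (auto simp: ennreal_add_less_top order.strict_trans1)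
    have "local_measure_nbhd M f (A \<union> B) (min e d) \<subseteq> S \<inter> T"
      using local_measure_nbhd_mono[OF fL AB A(1), of "min e d" e]
        local_measure_nbhd_mono[OF fL AB B(1), of "min e d" d] A(4) B(4) by auto
    then show "\<exists>C\<in>sets M. emeasure M C < \<infinity> \<and> (\<exists>e>0. local_measure_nbhd M f C e \<subseteq> S \<inter> T)"
      using AB A(3) B(3) by (intro bexI[of _ "A \<union> B"]) (auto intro!: exI[of _ "min e d"])
  qed
next
  fix \<U> :: "('a \<Rightarrow> 'k) set set"
  assume "\<forall>U\<in>\<U>. local_measure_open M U"
  then show "local_measure_open M (\<Union>\<U>)"
    unfolding local_measure_open_def by (meson Sup_least Sup_upper UnionE order_trans)
qed

lemma openin_local_measure_topology: "openin (local_measure_topology M) = local_measure_open M"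
  unfolding local_measure_topology_def
  by (rule topology_inverse'[OF istopology_local_measure_open])

definition fatou_property ::
  "'a measure \<Rightarrow> ('a \<Rightarrow> 'k::{real_normed_field, euclidean_space}) set \<Rightarrow> (('a \<Rightarrow> 'k) \<Rightarrow> real) \<Rightarrow> bool"
where
  "fatou_property M X N \<longleftrightarrow> closedin (local_measure_topology M) {f \<in> X. N f \<le> 1}"

definition norm_separable :: "('a \<Rightarrow> 'k::real_normed_field) set \<Rightarrow> (('a \<Rightarrow> 'k) \<Rightarrow> real) \<Rightarrow> bool" where
  "norm_separable X N \<longleftrightarrow>
     (\<exists>D\<subseteq>X. countable D \<and> (\<forall>f\<in>X. \<forall>e>0. \<exists>g\<in>D. N (\<lambda>x. f x - g x) < e))"

text \<open>
  Functionals are required to vanish outside the carrier, so that each element of the dual space is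
  represented by exactly one HOL function. A dual space is again a space of \<open>'k\<close>-valued functions,
  so the construction can be iterated.
\<close>

definition dual_space ::
  "('a \<Rightarrow> 'k::real_normed_field) set \<Rightarrow> (('a \<Rightarrow> 'k) \<Rightarrow> real) \<Rightarrow> (('a \<Rightarrow> 'k) \<Rightarrow> 'k) set" where
  "dual_space X N = {\<phi>.
     (\<forall>f\<in>X. \<forall>g\<in>X. \<phi> (\<lambda>x. f x + g x) = \<phi> f + \<phi> g) \<and>
     (\<forall>c. \<forall>f\<in>X. \<phi> (\<lambda>x. c * f x) = c * \<phi> f) \<and>
     (\<exists>C. \<forall>f\<in>X. norm (\<phi> f) \<le> C * N f) \<and>
     (\<forall>f. f \<notin> X \<longrightarrow> \<phi> f = 0)}"

definition dual_norm ::
  "('a \<Rightarrow> 'k::real_normed_field) set \<Rightarrow> (('a \<Rightarrow> 'k) \<Rightarrow> real) \<Rightarrow> (('a \<Rightarrow> 'k) \<Rightarrow> 'k) \<Rightarrow> real" where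
  "dual_norm X N \<phi> = (SUP f\<in>{f \<in> X. N f \<le> 1}. norm (\<phi> f))"

definition reflexive_space :: "('a \<Rightarrow> 'k::real_normed_field) set \<Rightarrow> (('a \<Rightarrow> 'k) \<Rightarrow> real) \<Rightarrow> bool" where
  "reflexive_space X N \<longleftrightarrow>
     (\<forall>F \<in> dual_space (dual_space X N) (dual_norm X N).
        \<exists>f\<in>X. \<forall>\<phi>\<in>dual_space X N. F \<phi> = \<phi> f)"

definition op_norm ::
  "('a \<Rightarrow> 'k::real_normed_field) set \<Rightarrow> (('a \<Rightarrow> 'k) \<Rightarrow> real) \<Rightarrow> (('b \<Rightarrow> 'k) \<Rightarrow> real) \<Rightarrow>
   (('a \<Rightarrow> 'k) \<Rightarrow> ('b \<Rightarrow> 'k)) \<Rightarrow> real" where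
  "op_norm X NX NY T = (SUP f\<in>{f \<in> X. NX f \<le> 1}. NY (T f))"

definition bounded_operator ::
  "('a \<Rightarrow> 'k::real_normed_field) set \<Rightarrow> (('a \<Rightarrow> 'k) \<Rightarrow> real) \<Rightarrow>
   ('b \<Rightarrow> 'k) set \<Rightarrow> (('b \<Rightarrow> 'k) \<Rightarrow> real) \<Rightarrow> (('a \<Rightarrow> 'k) \<Rightarrow> ('b \<Rightarrow> 'k)) \<Rightarrow> bool" where
  "bounded_operator X NX Y NY T \<longleftrightarrow>
     T ` X \<subseteq> Y \<and>
     (\<forall>f\<in>X. \<forall>g\<in>X. T (\<lambda>x. f x + g x) = (\<lambda>y. T f y + T g y)) \<and>
     (\<forall>c. \<forall>f\<in>X. T (\<lambda>x. c * f x) = (\<lambda>y. c * T f y)) \<and>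
     (\<exists>C. \<forall>f\<in>X. NY (T f) \<le> C * NX f)"

definition compact_operator ::
  "('a \<Rightarrow> 'k::real_normed_field) set \<Rightarrow> (('a \<Rightarrow> 'k) \<Rightarrow> real) \<Rightarrow>
   ('b \<Rightarrow> 'k) set \<Rightarrow> (('b \<Rightarrow> 'k) \<Rightarrow> real) \<Rightarrow> (('a \<Rightarrow> 'k) \<Rightarrow> ('b \<Rightarrow> 'k)) \<Rightarrow> bool" where
  "compact_operator X NX Y NY T \<longleftrightarrow>
     bounded_operator X NX Y NY T \<and>
     (\<forall>F :: nat \<Rightarrow> 'a \<Rightarrow> 'k. (\<forall>n. F n \<in> X \<and> NX (F n) \<le> 1) \<longrightarrow>
        (\<exists>g\<in>Y. \<exists>r. strict_mono r \<and> (\<lambda>n. NY (\<lambda>y. T (F (r n)) y - g y)) \<longlonglongrightarrow> 0))"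

definition ess_norm ::
  "('a \<Rightarrow> 'k::real_normed_field) set \<Rightarrow> (('a \<Rightarrow> 'k) \<Rightarrow> real) \<Rightarrow>
   ('b \<Rightarrow> 'k) set \<Rightarrow> (('b \<Rightarrow> 'k) \<Rightarrow> real) \<Rightarrow> (('a \<Rightarrow> 'k) \<Rightarrow> ('b \<Rightarrow> 'k)) \<Rightarrow> real" where
  "ess_norm X NX Y NY T =
     (INF K\<in>{K. compact_operator X NX Y NY K}. op_norm X NX NY (\<lambda>f y. T f y - K f y))"

definition mult_space ::
  "('a \<Rightarrow> 'k::real_normed_field) set \<Rightarrow> ('a \<Rightarrow> 'k) set \<Rightarrow> ('a \<Rightarrow> 'k) set" where
  "mult_space X Y = {g. \<forall>f\<in>X. (\<lambda>x. f x * g x) \<in> Y}"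

definition mult_norm ::
  "('a \<Rightarrow> 'k::real_normed_field) set \<Rightarrow> (('a \<Rightarrow> 'k) \<Rightarrow> real) \<Rightarrow> (('a \<Rightarrow> 'k) \<Rightarrow> real) \<Rightarrow>
   ('a \<Rightarrow> 'k) \<Rightarrow> real" where
  "mult_norm X NX NY g = (SUP f\<in>{f \<in> X. NX f \<le> 1}. NY (\<lambda>x. f x * g x))"

definition mult_op :: "('a \<Rightarrow> 'k::real_normed_field) \<Rightarrow> ('a \<Rightarrow> 'k) \<Rightarrow> ('a \<Rightarrow> 'k)" where
  "mult_op l f = (\<lambda>x. l x * f x)"

text \<open>
  The nonnegative elements of \<open>Z\<close> are written \<open>\<lambda>x. of_real (h x)\<close> with \<open>h\<close> real-valued and
  nonnegative.
\<close>

definition order_continuous_part ::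
  "'a measure \<Rightarrow> ('a \<Rightarrow> 'k::real_normed_field) set \<Rightarrow> (('a \<Rightarrow> 'k) \<Rightarrow> real) \<Rightarrow> ('a \<Rightarrow> 'k) set" where
  "order_continuous_part M Z N = {f \<in> Z.
     \<forall>h :: nat \<Rightarrow> 'a \<Rightarrow> real.
       (\<forall>n. (\<lambda>x. of_real (h n x)) \<in> Z) \<longrightarrow>
       (\<forall>n. \<forall>x\<in>space M. 0 \<le> h n x \<and> h n x \<le> norm (f x)) \<longrightarrow>
       (\<forall>x\<in>space M. decseq (\<lambda>n. h n x) \<and> (\<lambda>n. h n x) \<longlonglongrightarrow> 0) \<longrightarrow>
       (\<lambda>n. N (\<lambda>x. of_real (h n x))) \<longlonglongrightarrow> 0}"

definition tail_seq :: "nat \<Rightarrow> (nat \<Rightarrow> 'k::real_normed_field) \<Rightarrow> nat \<Rightarrow> 'k" where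
  "tail_seq n l = (\<lambda>i. if n \<le> i then l i else 0)"

end

theory Submission
  imports Defs "HOL-Complex_Analysis.Great_Picard"
begin

text \<open>
  Write \<open>q n\<close> for the multiplier norm of the tail of \<open>l\<close> from index \<open>n\<close> on. The sequence \<open>q\<close> is
  decreasing, so it has a limit \<open>L\<close>, and both inequalities between \<open>L\<close> and the essential norm have to
  be shown.

  The essential norm is at most \<open>q n\<close> for each \<open>n\<close>, because multiplication by the head of \<open>l\<close> has finite
  rank: it is a compact operator whose difference from \<open>mult_op l\<close> is multiplication by the tail.

  Conversely, let \<open>K\<close> be compact. Choose \<open>F k\<close> in the unit ball of \<open>X\<close>, vanishing below index \<open>k\<close>, on
  which multiplication by \<open>l\<close> almost attains \<open>q k\<close>. Along a subsequence, \<open>K (F k)\<close> converges in norm to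
  some \<open>g\<close> in \<open>Y\<close>. The function \<open>l * F k\<close> lives on the indices from \<open>k\<close> on, so cutting the
  difference of \<open>l * F k\<close> and \<open>K (F k)\<close> down to these indices gives, up to a null sequence,
  \<open>q k \<le> op_norm (mult_op l - K) + NY (tail_seq k g)\<close>. Hence everything reduces to the tails of \<open>g\<close>
  tending to zero in norm (\<open>tail_norm_limit_le_op_norm_diff\<close>). There are two reasons for this, one for
  each of the alternative hypotheses
  (\<open>tail_tendsto_0_if_reflexive_or_separable\<close>).

  \<^item> If \<open>Y\<close> is separable, then the tails of every element of \<open>Y\<close> tend to zero. Otherwise the Fatou
    property provides disjoint finite blocks of some \<open>y\<close> with norms bounded away from zero, and the
    restrictions of \<open>y\<close> to the unions of these blocks form an uncountable uniformly separated family
    (\<open>separable_norm_tail_tendsto_0\<close>).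

  \<^item> If \<open>X\<close> is reflexive, then even \<open>g = 0\<close>. A limit along an ultrafilter turns the bounded sequence \<open>F\<close>
    into an element of the bidual, which reflexivity represents by an element of \<open>X\<close>. Its coordinates
    are the limits of the coordinates of \<open>F k\<close>, so it is zero. Applying this to the functional
    \<open>f \<mapsto> (K f) i\<close> gives \<open>g i = 0\<close> (\<open>reflexive_functional_limit_0\<close>).

  For the characterization of compactness, order continuity of \<open>l\<close> and compactness of \<open>mult_op l\<close> are
  both equivalent to \<open>q\<close> tending to zero.
\<close>

section \<open>Limits along an ultrafilter\<close>

text \<open>
  The minimal proper filters are the ultrafilters. Zorn's lemma applies because the infimum of a
  chain of proper filters is proper.
\<close>

lemma minimal_filter_exists:
  fixes F :: "'a filter"
  assumes "F \<noteq> bot"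
  obtains U where "U \<le> F" "U \<noteq> bot" "\<And>G. G \<le> U \<Longrightarrow> G \<noteq> bot \<Longrightarrow> G = U"
proof -
  define A where "A = {G. G \<le> F \<and> G \<noteq> bot}"
  have po: "partial_order_on A (relation_of (\<ge>) A)"
    by (rule partial_order_on_relation_ofI) auto
  have "\<exists>m\<in>A. \<forall>a\<in>A. m \<ge> a \<longrightarrow> a = m"
  proof (rule predicate_Zorn[OF po])
    fix C assume C: "C \<in> Chains (relation_of (\<ge>) A)"
    show "\<exists>u\<in>A. \<forall>a\<in>C. a \<ge> u"
    proof (cases "C = {}")
      case True
      then show ?thesis using assms by (auto simp: A_def)
    next
      case False
      have tot: "G \<le> H \<or> H \<le> G" if "G \<in> C" "H \<in> C" for G H
        using C that by (auto simp: Chains_def relation_of_def)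
      have CA: "C \<subseteq> A"
        using C by (auto simp: Chains_def relation_of_def)
      have base: "\<exists>x\<in>C. x \<le> inf G H" if "G \<in> C" "H \<in> C" for G H
        using tot[OF that] that by (auto simp: inf.absorb1 inf.absorb2)
      have "Inf C \<noteq> bot"
        using CA eventually_Inf_base[OF False base, of "\<lambda>_. False"] by (auto simp: A_def)
      moreover have "Inf C \<le> F"
        using False CA Inf_lower2[of _ C F] by (auto simp: A_def)
      ultimately have "Inf C \<in> A" by (simp add: A_def)
      then show ?thesis using Inf_lower by blast
    qed
  qed
  then show thesis using that by (auto simp: A_def)
qed

text \<open>
  Compactness provides a cluster point of \<open>f\<close> along \<open>U\<close>. The filter \<open>U\<close> refined by the preimages of the
  neighbourhoods of that point is proper, hence equal to \<open>U\<close> by minimality, and so the cluster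
  point is a limit.
\<close>

lemma minimal_filter_tendsto:
  assumes U: "U \<noteq> bot" "\<And>G. G \<le> U \<Longrightarrow> G \<noteq> bot \<Longrightarrow> G = U"
    and S: "compact S" "\<And>x. f x \<in> S"
  obtains a where "(f \<longlongrightarrow> a) U"
proof -
  have "filtermap f U \<noteq> bot" using U(1) by (simp add: filtermap_bot_iff)
  then obtain a where a: "inf (nhds a) (filtermap f U) \<noteq> bot"
    using S unfolding compact_filter by (auto simp: eventually_filtermap)
  have "inf U (filtercomap f (nhds a)) \<noteq> bot"
  proof
    assume "inf U (filtercomap f (nhds a)) = bot"
    then obtain P Q where P: "eventually P U" and Q: "eventually Q (filtercomap f (nhds a))"
      and PQ: "\<And>x. P x \<Longrightarrow> Q x \<Longrightarrow> False"
      unfolding trivial_limit_def eventually_inf by blast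
    obtain R where R: "eventually R (nhds a)" "\<And>x. R (f x) \<Longrightarrow> Q x"
      using Q unfolding eventually_filtercomap by blast
    have "eventually (\<lambda>y. \<not> R y) (filtermap f U)"
      unfolding eventually_filtermap by (rule eventually_mono[OF P]) (use PQ R in blast)
    with R(1) have "inf (nhds a) (filtermap f U) = bot"
      unfolding trivial_limit_def eventually_inf by blast
    with a show False by simp
  qed
  then have "inf U (filtercomap f (nhds a)) = U" by (intro U(2)) auto
  then have "U \<le> filtercomap f (nhds a)" by (rule inf.orderI[OF sym])
  then have "(f \<longlongrightarrow> a) U"
    by (simp add: filterlim_def filtermap_le_iff_le_filtercomap)
  then show thesis by (rule that)
qed

text \<open>
  This is a generalized limit: it is linear and multiplicative by the usual limit rules, agrees with
  the ordinary limit of convergent sequences, and is defined for all bounded sequences.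
\<close>

lemma ultralimit_exists:
  obtains U :: "nat filter" where "U \<noteq> bot" "U \<le> sequentially"
    "\<And>f :: nat \<Rightarrow> 'b::heine_borel. bounded (range f) \<Longrightarrow> \<exists>a. (f \<longlongrightarrow> a) U"
proof -
  obtain U :: "nat filter" where U: "U \<le> sequentially" "U \<noteq> bot"
      "\<And>G. G \<le> U \<Longrightarrow> G \<noteq> bot \<Longrightarrow> G = U"
    using minimal_filter_exists[OF sequentially_bot] by blast
  show thesis
  proof (rule that[OF U(2,1)])
    fix f :: "nat \<Rightarrow> 'b" assume "bounded (range f)"
    then have compact: "compact (closure (range f))" by simp
    have range: "f n \<in> closure (range f)" for n
      by (rule subsetD[OF closure_subset]) simp
    obtain a where "(f \<longlongrightarrow> a) U"
      by (rule minimal_filter_tendsto[OF U(2,3) compact range])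
    then show "\<exists>a. (f \<longlongrightarrow> a) U" ..
  qed
qed

section \<open>Koethe sequence spaces\<close>

definition head_seq :: "nat \<Rightarrow> (nat \<Rightarrow> 'k::real_normed_field) \<Rightarrow> nat \<Rightarrow> 'k" where
  "head_seq n f = (\<lambda>i. if i < n then f i else 0)"

lemma tail_seq_add_head_seq: "(\<lambda>i. head_seq n f i + tail_seq n f i) = f"
  by (auto simp: head_seq_def tail_seq_def)

context kothe_sequence_space
begin

lemma AE_iff_all: "(AE x in M. P x) \<longleftrightarrow> (\<forall>x. P x)"
proof
  assume "AE x in M. P x"
  then obtain Z where Z: "{x \<in> space M. \<not> P x} \<subseteq> Z" "emeasure M Z = 0" "Z \<in> sets M"
    by (rule AE_E)
  show "\<forall>x. P x"
  proof (rule allI, rule ccontr)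
    fix x assume "\<not> P x"
    then have "{x} \<subseteq> Z" using Z by (auto simp: space_eq)
    then have "emeasure M {x} \<le> emeasure M Z" using Z by (intro emeasure_mono) auto
    then show False using atom_pos[of x] Z by simp
  qed
qed simp

lemma borel_measurable_any: "f \<in> borel_measurable M"
  by (auto simp: measurable_def space_eq sets_eq)

lemma dominated_mem: "g \<in> X \<Longrightarrow> (\<And>i. norm (f i) \<le> norm (g i)) \<Longrightarrow> f \<in> X"
  by (rule ideal_mem[OF borel_measurable_any]) (auto simp: AE_iff_all)

lemma dominated_norm: "g \<in> X \<Longrightarrow> (\<And>i. norm (f i) \<le> norm (g i)) \<Longrightarrow> N f \<le> N g"
  by (rule ideal_norm[OF borel_measurable_any]) (auto simp: AE_iff_all)

lemma norm_eq_0: "f \<in> X \<Longrightarrow> N f = 0 \<longleftrightarrow> f = (\<lambda>i. 0)"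
  using norm_eq_0_iff[of f] by (auto simp: AE_iff_all)

lemma norm_zero [simp]: "N (\<lambda>i. 0) = 0"
  using norm_eq_0[OF zero_mem] by simp

lemma diff_mem: "f \<in> X \<Longrightarrow> g \<in> X \<Longrightarrow> (\<lambda>i. f i - g i) \<in> X"
  using add_mem[of f "\<lambda>i. (-1) * g i"] scale_mem[of g "-1"] by simp

lemma norm_minus_triangle:
  assumes "f \<in> X" "g \<in> X"
  shows "N (\<lambda>i. f i - g i) \<le> N f + N g"
  using norm_triangle[OF assms(1) scale_mem[OF assms(2), of "-1"]] norm_scale[OF assms(2), of "-1"]
  by simp

lemma head_mem: "f \<in> X \<Longrightarrow> head_seq n f \<in> X"
  by (erule dominated_mem) (auto simp: head_seq_def)

lemma tail_mem: "f \<in> X \<Longrightarrow> tail_seq n f \<in> X"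
  by (erule dominated_mem) (auto simp: tail_seq_def)

lemma norm_tail_le: "f \<in> X \<Longrightarrow> N (tail_seq n f) \<le> N f"
  by (erule dominated_norm) (auto simp: tail_seq_def)

lemma norm_le_head_add_tail: "f \<in> X \<Longrightarrow> N f \<le> N (head_seq n f) + N (tail_seq n f)"
  using norm_triangle[OF head_mem tail_mem, of f f n n] by (simp add: tail_seq_add_head_seq)

lemma unit_mem: "indicator {i} \<in> X"
  using atom_finite[of i] by (intro indicator_mem) (simp_all add: sets_eq)

lemma norm_unit_pos: "N (indicator {i}) > 0"
proof -
  have "(indicator {i} :: nat \<Rightarrow> 'k) \<noteq> (\<lambda>i. 0)"
    by (auto simp: fun_eq_iff indicator_def)
  then show ?thesis
    using norm_nonneg[OF unit_mem, of i] norm_eq_0[OF unit_mem, of i] by simp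
qed

lemma coordinate_bound:
  assumes "f \<in> X" shows "norm (f i) * N (indicator {i}) \<le> N f"
proof -
  have "N (\<lambda>j. f i * indicator {i} j) \<le> N f"
    using assms by (rule dominated_norm) (auto simp: indicator_def)
  then show ?thesis by (simp add: norm_scale[OF unit_mem])
qed

lemma norm_head_le:
  assumes "f \<in> X" shows "N (head_seq n f) \<le> (\<Sum>i<n. norm (f i) * N (indicator {i}))"
proof (induction n)
  case 0
  then show ?case by (simp add: head_seq_def)
next
  case (Suc n)
  have "head_seq (Suc n) f = (\<lambda>i. head_seq n f i + f n * indicator {n} i)"
    by (auto simp: head_seq_def indicator_def fun_eq_iff less_Suc_eq)
  then have "N (head_seq (Suc n) f) \<le> N (head_seq n f) + N (\<lambda>i. f n * indicator {n} i)"
    using norm_triangle[OF head_mem[OF assms] scale_mem[OF unit_mem]] by metis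
  then show ?case using Suc by (simp add: norm_scale[OF unit_mem])
qed

lemma norm_tendsto_imp_coordinate_tendsto:
  assumes "\<And>n. F n \<in> X" "f \<in> X" "(\<lambda>n. N (\<lambda>i. F n i - f i)) \<longlonglongrightarrow> 0"
  shows "(\<lambda>n. F n i) \<longlonglongrightarrow> f i"
proof -
  have bound: "norm (F n i - f i) \<le> N (\<lambda>j. F n j - f j) / N (indicator {i})" for n
    using coordinate_bound[OF diff_mem[OF assms(1)[of n] assms(2)], of i] norm_unit_pos[of i]
    by (simp add: field_simps)
  have "(\<lambda>n. F n i - f i) \<longlonglongrightarrow> 0"
    by (rule Lim_null_comparison[OF always_eventually[OF allI[OF bound]]
          tendsto_divide_zero[OF assms(3)]])
  then show ?thesis by (simp add: LIM_zero_iff)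
qed

text \<open>
  The heads of \<open>y\<close> converge to \<open>y\<close> locally in measure, since a set \<open>A\<close> of finite measure satisfies
  \<open>measure M (A \<inter> {n..}) \<longlonglongrightarrow> 0\<close>. So the Fatou property passes a norm bound on the heads on to \<open>y\<close>.
\<close>

lemma fatou_norm_le:
  assumes fatou: "fatou_property M X N" and y: "y \<in> X" and c: "c > 0"
    and le: "\<And>n. N (head_seq n y) \<le> c"
  shows "N y \<le> c"
proof (rule ccontr)
  assume "\<not> N y \<le> c"
  \<comment> \<open>Rescaling moves the heads into the unit ball and leaves the limit outside of it.\<close>
  define z where "z = (\<lambda>i. of_real (1 / c) * y i)"
  have z: "z \<in> X" unfolding z_def by (rule scale_mem[OF y])
  have Nz: "N z > 1"
    using \<open>\<not> N y \<le> c\<close> c unfolding z_def norm_scale[OF y] by (simp add: norm_divide)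
  have hz: "head_seq n z = (\<lambda>i. of_real (1 / c) * head_seq n y i)" for n
    by (auto simp: head_seq_def z_def)
  have Nhz: "N (head_seq n z) \<le> 1" for n
    using le[of n] c unfolding hz norm_scale[OF head_mem[OF y]] by (simp add: norm_divide)
  have "openin (local_measure_topology M) (topspace (local_measure_topology M) - {f \<in> X. N f \<le> 1})"
    using fatou by (simp add: fatou_property_def openin_diff)
  moreover have "local_measure_open M (L0 M :: (nat \<Rightarrow> 'k) set)"
    unfolding local_measure_open_def
    by (auto simp: local_measure_nbhd_def intro!: bexI[of _ "{}"] exI[of _ "1::real"])
  then have "topspace (local_measure_topology M) = (L0 M :: (nat \<Rightarrow> 'k) set)"
    using openin_topspace[of "local_measure_topology M :: (nat \<Rightarrow> 'k) topology"]
    unfolding openin_local_measure_topology[symmetric]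
    by (intro antisym openin_subset) (auto simp: openin_local_measure_topology local_measure_open_def)
  ultimately have "local_measure_open M (L0 M - {f \<in> X. N f \<le> 1})"
    by (simp add: openin_local_measure_topology)
  moreover have "z \<in> L0 M - {f \<in> X. N f \<le> 1}"
    using z Nz subset_L0 by auto
  ultimately obtain A e where A: "A \<in> sets M" "emeasure M A < \<infinity>" "e > 0"
    and sub: "local_measure_nbhd M z A e \<subseteq> L0 M - {f \<in> X. N f \<le> 1}"
    unfolding local_measure_open_def by blast
  have "(\<lambda>n. measure M (A \<inter> {n..})) \<longlonglongrightarrow> measure M (\<Inter>n. A \<inter> {n..})"
  proof (rule Lim_measure_decseq)
    show "emeasure M (A \<inter> {i..}) \<noteq> \<infinity>" for i
      using emeasure_mono[of "A \<inter> {i..}" A M] A by (auto simp: top_unique)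
  qed (auto simp: sets_eq decseq_def)
  moreover have "(\<Inter>n. A \<inter> {n..}) = {}"
  proof -
    have "x \<notin> (\<Inter>n. A \<inter> {n..})" for x
      by (auto intro!: exI[of _ "Suc x"])
    then show ?thesis by blast
  qed
  ultimately have "(\<lambda>n. measure M (A \<inter> {n..})) \<longlonglongrightarrow> 0" by simp
  then obtain n where n: "measure M (A \<inter> {n..}) < e"
    using A(3) by (metis order_tendstoD(2) eventually_sequentially order_refl)
  have "measure M {x \<in> A. norm (head_seq n z x - z x) > e} \<le> measure M (A \<inter> {n..})"
  proof (rule measure_mono_fmeasurable)
    show "{x \<in> A. norm (head_seq n z x - z x) > e} \<subseteq> A \<inter> {n..}"
      using A(3) by (auto simp: head_seq_def not_less[symmetric] split: if_splits)
    have "emeasure M (A \<inter> {n..}) < \<infinity>"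
      using emeasure_mono[of "A \<inter> {n..}" A M] A by (auto simp: order.strict_trans1)
    then show "A \<inter> {n..} \<in> fmeasurable M"
      by (auto simp: fmeasurable_def sets_eq)
  qed (auto simp: sets_eq)
  then have "head_seq n z \<in> local_measure_nbhd M z A e"
    using n head_mem[OF z, of n] subset_L0 by (auto simp: local_measure_nbhd_def)
  then show False using sub Nhz[of n] head_mem[OF z, of n] by auto
qed

text \<open>
  If the decreasing norms of the tails stay above some \<open>d > 0\<close>, then \<open>fatou_norm_le\<close> cuts off from
  each tail a finite block of norm greater than \<open>d\<close>. Lining up such blocks, every set \<open>S\<close> of block
  numbers gives the restriction of \<open>y\<close> to the blocks in \<open>S\<close>. Two different restrictions are more than
  \<open>d\<close> apart, so a countable dense set would make the power set of the naturals countable.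
\<close>

lemma separable_norm_tail_tendsto_0:
  assumes fatou: "fatou_property M X N" and sep: "norm_separable X N" and y: "y \<in> X"
  shows "(\<lambda>n. N (tail_seq n y)) \<longlonglongrightarrow> 0"
proof (rule ccontr)
  assume not0: "\<not> ?thesis"
  have mono: "N (tail_seq n y) \<le> N (tail_seq m y)" if "m \<le> n" for m n
    using that by (intro dominated_norm tail_mem y) (auto simp: tail_seq_def)
  obtain d where d: "d > 0" "\<And>n. N (tail_seq n y) > d"
  proof -
    obtain e where e: "e > 0" "\<And>n0. \<exists>n\<ge>n0. N (tail_seq n y) \<ge> e"
      using not0 norm_nonneg[OF tail_mem[OF y]] unfolding LIMSEQ_iff
      by (auto simp: not_less)
    have "N (tail_seq n y) \<ge> e" for n
      using e(2)[of n] mono by (meson order_trans)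
    \<comment> \<open>Halving makes the inequality strict, so that the Fatou bound by \<open>d\<close> below contradicts it.\<close>
    then have "N (tail_seq n y) > e / 2" for n
      using e(1) by (smt (verit) field_sum_of_halves)
    then show thesis using that[of "e/2"] e(1) by auto
  qed
  have "\<exists>m>n. N (head_seq m (tail_seq n y)) > d" for n
  proof (rule ccontr)
    assume c: "\<not> ?thesis"
    have "N (head_seq m (tail_seq n y)) \<le> d" for m
    proof (cases "m > n")
      case False
      then have "head_seq m (tail_seq n y) = (\<lambda>i. 0)"
        by (auto simp: head_seq_def tail_seq_def)
      then show ?thesis using d(1) by simp
    next
      case True
      then show ?thesis using c by (meson not_le)
    qed
    from fatou_norm_le[OF fatou tail_mem[OF y] d(1) this] d(2)[of n] show False by simp
  qed
  then obtain b where b: "\<And>n. b n > n" "\<And>n. N (head_seq (b n) (tail_seq n y)) > d"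
    by metis
  \<comment> \<open>The \<open>k\<close>-th block is the interval from \<open>p k\<close> up to, but excluding, \<open>p (Suc k)\<close>.\<close>
  define p where "p k = (b ^^ k) 0" for k
  have pS: "p (Suc k) = b (p k)" for k by (simp add: p_def)
  have "strict_mono p" by (simp add: strict_mono_Suc_iff pS b)
  then have pmono: "p i \<le> p j" if "i \<le> j" for i j
    using that by (simp add: strict_mono_less_eq)
  have block_unique: "k = k'"
    if "p k \<le> i" "i < p (Suc k)" "p k' \<le> i" "i < p (Suc k')" for k k' i
    using pmono[of "Suc k" k'] pmono[of "Suc k'" k] that by (cases k k' rule: linorder_cases) auto
  define Z where "Z S = (\<lambda>i. if \<exists>k\<in>S. p k \<le> i \<and> i < p (Suc k) then y i else 0)" for S
  have Z: "Z S \<in> X" for S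
    using y by (rule dominated_mem) (auto simp: Z_def)
  have far1: "N (\<lambda>i. Z S i - Z T i) > d" if "k \<in> S" "k \<notin> T" for S T k
  proof -
    have "N (head_seq (b (p k)) (tail_seq (p k) y)) \<le> N (\<lambda>i. Z S i - Z T i)"
    proof (rule dominated_norm[OF diff_mem[OF Z Z]])
      fix i
      show "norm (head_seq (b (p k)) (tail_seq (p k) y) i) \<le> norm (Z S i - Z T i)"
      proof (cases "p k \<le> i \<and> i < p (Suc k)")
        case True
        then have "Z S i = y i" using that by (auto simp: Z_def)
        moreover have "Z T i = 0" using that True block_unique[of k i] by (auto simp: Z_def)
        ultimately show ?thesis by (auto simp: head_seq_def tail_seq_def)
      qed (auto simp: head_seq_def tail_seq_def pS)
    qed
    with b(2)[of "p k"] show ?thesis by linarith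
  qed
  have comm: "N (\<lambda>i. Z S i - Z T i) \<le> N (\<lambda>i. Z T i - Z S i)" for S T
    by (rule dominated_norm[OF diff_mem[OF Z Z]]) (simp add: norm_minus_commute)
  have far: "N (\<lambda>i. Z S i - Z T i) > d" if "S \<noteq> T" for S T
  proof -
    from that obtain k where "k \<in> S \<and> k \<notin> T \<or> k \<in> T \<and> k \<notin> S" by blast
    then show ?thesis using far1[of k S T] far1[of k T S] comm[of T S] by fastforce
  qed
  obtain D where D: "D \<subseteq> X" "countable D" "\<And>f e. f \<in> X \<Longrightarrow> e > 0 \<Longrightarrow> \<exists>g\<in>D. N (\<lambda>x. f x - g x) < e"
    using sep unfolding norm_separable_def by blast
  have "\<exists>g\<in>D. N (\<lambda>x. Z S x - g x) < d / 2" for S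
    by (rule D(3)[OF Z half_gt_zero[OF d(1)]])
  then obtain G where G: "\<And>S. G S \<in> D" "\<And>S. N (\<lambda>x. Z S x - G S x) < d / 2"
    by metis
  \<comment> \<open>Two sets with a common approximant would have restrictions of distance less than \<open>d\<close>.\<close>
  have "inj G"
  proof (rule injI, rule ccontr)
    fix S T assume eq: "G S = G T" and ne: "S \<noteq> T"
    have "N (\<lambda>i. (Z S i - G S i) - (Z T i - G T i))
        \<le> N (\<lambda>i. Z S i - G S i) + N (\<lambda>i. Z T i - G T i)"
      using G(1) D(1) by (intro norm_minus_triangle diff_mem Z) auto
    then show False using G(2)[of S] G(2)[of T] far[OF ne] eq by simp
  qed
  moreover have "countable (range G)"
    by (rule countable_subset[OF _ D(2)]) (use G(1) in auto)
  ultimately have "countable (UNIV :: nat set set)"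
    by (metis countable_image_inj_on)
  then have "range (from_nat_into (UNIV :: nat set set)) = UNIV"
    by (intro range_from_nat_into) auto
  then show False using Cantors_theorem[of "UNIV :: nat set"] by auto
qed

lemma dual_space_bound:
  assumes "\<phi> \<in> dual_space X N"
  obtains C where "\<And>f. f \<in> X \<Longrightarrow> norm (\<phi> f) \<le> C * N f"
  using assms unfolding dual_space_def by blast

lemma coordinate_functional: "(\<lambda>f. if f \<in> X then f i else 0) \<in> dual_space X N"
proof -
  have "norm (f i) \<le> 1 / N (indicator {i}) * N f" if "f \<in> X" for f
    using coordinate_bound[OF that, of i] norm_unit_pos[of i] by (simp add: field_simps)
  then show ?thesis
    unfolding dual_space_def by (auto simp: add_mem scale_mem intro!: exI[of _ "1 / N (indicator {i})"])
qed

lemma dual_norm_upper: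
  assumes "\<phi> \<in> dual_space X N" "f \<in> X" "N f \<le> 1"
  shows "norm (\<phi> f) \<le> dual_norm X N \<phi>"
proof -
  obtain C where C: "\<And>f. f \<in> X \<Longrightarrow> norm (\<phi> f) \<le> C * N f"
    using dual_space_bound[OF assms(1)] by blast
  have "norm (\<phi> g) \<le> \<bar>C\<bar>" if "g \<in> X" "N g \<le> 1" for g
  proof -
    have "norm (\<phi> g) \<le> C * N g" by (rule C[OF that(1)])
    also have "\<dots> \<le> \<bar>C\<bar> * 1"
      using that norm_nonneg[of g] by (intro mult_mono) auto
    finally show ?thesis by simp
  qed
  then show ?thesis
    unfolding dual_norm_def using assms(2,3)
    by (intro cSUP_upper) (auto intro!: bdd_aboveI[of _ "\<bar>C\<bar>"])
qed

text \<open>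
  The functional \<open>F \<psi> = lim\<^sub>U \<psi> (f k)\<close> on the dual space is bounded by 1, so reflexivity gives some \<open>g\<close>
  in \<open>X\<close> that represents it. Testing \<open>F\<close> on the coordinate functionals shows \<open>g = 0\<close>. Since \<open>F\<close> extends
  the ordinary limit, this determines the limit of \<open>\<phi> (f k)\<close>. In effect, coordinatewise null sequences
  in the ball of a reflexive space are weakly null.
\<close>

lemma reflexive_functional_limit_0:
  assumes refl: "reflexive_space X N"
    and f: "\<And>k. f k \<in> X" "\<And>k. N (f k) \<le> 1" "\<And>i. (\<lambda>k. f k i) \<longlonglongrightarrow> 0"
    and \<phi>: "\<phi> \<in> dual_space X N" "(\<lambda>k. \<phi> (f k)) \<longlonglongrightarrow> a"
  shows "a = 0"
proof -
  obtain U :: "nat filter" where U: "U \<noteq> bot" "U \<le> sequentially"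
    and conv: "\<And>f :: nat \<Rightarrow> 'k. bounded (range f) \<Longrightarrow> \<exists>a. (f \<longlongrightarrow> a) U"
    using ultralimit_exists by blast
  define F where "F \<psi> = (if \<psi> \<in> dual_space X N then Lim U (\<lambda>k. \<psi> (f k)) else 0)" for \<psi>
  have F: "((\<lambda>k. \<psi> (f k)) \<longlongrightarrow> F \<psi>) U" if \<psi>: "\<psi> \<in> dual_space X N" for \<psi>
  proof -
    have "bounded (range (\<lambda>k. \<psi> (f k)))"
      using dual_norm_upper[OF \<psi> f(1,2)] by (auto simp: bounded_iff)
    then obtain b where "((\<lambda>k. \<psi> (f k)) \<longlongrightarrow> b) U" using conv by blast
    moreover from this have "Lim U (\<lambda>k. \<psi> (f k)) = b" by (rule tendsto_Lim[OF U(1)])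
    ultimately show ?thesis using \<psi> by (simp add: F_def)
  qed
  have F_eq: "F \<psi> = b" if "\<psi> \<in> dual_space X N" "((\<lambda>k. \<psi> (f k)) \<longlongrightarrow> b) U" for \<psi> b
    using tendsto_unique[OF U(1) F[OF that(1)] that(2)] .
  have add: "(\<lambda>x. \<psi> x + \<eta> x) \<in> dual_space X N"
    if "\<psi> \<in> dual_space X N" "\<eta> \<in> dual_space X N" for \<psi> \<eta>
  proof -
    obtain C where C: "\<And>f. f \<in> X \<Longrightarrow> norm (\<psi> f) \<le> C * N f"
      using dual_space_bound[OF \<open>\<psi> \<in> dual_space X N\<close>] by blast
    obtain D where D: "\<And>f. f \<in> X \<Longrightarrow> norm (\<eta> f) \<le> D * N f"
      using dual_space_bound[OF \<open>\<eta> \<in> dual_space X N\<close>] by blast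
    have "norm (\<psi> g + \<eta> g) \<le> (C + D) * N g" if "g \<in> X" for g
      using norm_triangle_ineq[of "\<psi> g" "\<eta> g"] C[OF that] D[OF that] by (simp add: algebra_simps)
    then have "\<exists>E. \<forall>g\<in>X. norm (\<psi> g + \<eta> g) \<le> E * N g" by blast
    then show ?thesis using that unfolding dual_space_def by (simp add: ac_simps distrib_left)
  qed
  have scale: "(\<lambda>x. c * \<psi> x) \<in> dual_space X N" if "\<psi> \<in> dual_space X N" for \<psi> c
  proof -
    obtain C where C: "\<And>f. f \<in> X \<Longrightarrow> norm (\<psi> f) \<le> C * N f"
      using dual_space_bound[OF \<open>\<psi> \<in> dual_space X N\<close>] by blast
    have "norm (c * \<psi> g) \<le> (norm c * C) * N g" if "g \<in> X" for g
      using mult_left_mono[OF C[OF that], of "norm c"] by (simp add: norm_mult algebra_simps)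
    then have "\<exists>E. \<forall>g\<in>X. norm (c * \<psi> g) \<le> E * N g" by blast
    then show ?thesis using that unfolding dual_space_def by (simp add: ac_simps distrib_left)
  qed
  have "F \<in> dual_space (dual_space X N) (dual_norm X N)"
    unfolding dual_space_def[of "dual_space X N"]
  proof (intro CollectI conjI ballI allI impI exI[of _ 1])
    fix \<psi> \<eta> assume "\<psi> \<in> dual_space X N" "\<eta> \<in> dual_space X N"
    then show "F (\<lambda>x. \<psi> x + \<eta> x) = F \<psi> + F \<eta>"
      by (intro F_eq add tendsto_add F)
  next
    fix c \<psi> assume "\<psi> \<in> dual_space X N"
    then show "F (\<lambda>x. c * \<psi> x) = c * F \<psi>"
      by (intro F_eq scale tendsto_mult tendsto_const F)
  next
    fix \<psi> assume \<psi>: "\<psi> \<in> dual_space X N"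
    have "norm (F \<psi>) \<le> dual_norm X N \<psi>"
      by (rule tendsto_upperbound[OF tendsto_norm[OF F[OF \<psi>]] _ U(1)])
         (simp add: dual_norm_upper[OF \<psi> f(1,2)])
    then show "norm (F \<psi>) \<le> 1 * dual_norm X N \<psi>" by simp
  qed (simp add: F_def)
  then obtain g where g: "g \<in> X" "\<And>\<psi>. \<psi> \<in> dual_space X N \<Longrightarrow> F \<psi> = \<psi> g"
    using refl unfolding reflexive_space_def by blast
  have "g i = 0" for i
  proof -
    have "F (\<lambda>h. if h \<in> X then h i else 0) = 0"
      by (rule F_eq[OF coordinate_functional]) (use f tendsto_mono[OF U(2) f(3)] in simp)
    then show ?thesis using g(2)[OF coordinate_functional[of i]] g(1) by simp
  qed
  then have "g = (\<lambda>i. 0 * g i)" by auto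
  then have "\<phi> g = 0 * \<phi> g" using \<phi>(1) g(1) by (force simp: dual_space_def)
  moreover have "F \<phi> = a" by (rule F_eq[OF \<phi>(1) tendsto_mono[OF U(2) \<phi>(2)]])
  ultimately show ?thesis using g(2)[OF \<phi>(1)] by simp
qed

text \<open>
  The coordinates of elements of the unit ball are bounded, but with a bound that depends on the
  index. Multiplying the \<open>i\<close>-th coordinate by the norm of the \<open>i\<close>-th unit vector makes the bound uniform,
  as the diagonal argument of \<open>function_convergent_subsequence\<close> requires.
\<close>

lemma coordinatewise_convergent_subsequence:
  assumes f: "\<And>n. f n \<in> X" "\<And>n. N (f n) \<le> 1"
  obtains r where "strict_mono (r :: nat \<Rightarrow> nat)" "\<And>i. convergent (\<lambda>n. f (r n) i)"
proof -
  have bound: "norm (f n i * of_real (N (indicator {i}))) \<le> 1" for n i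
    using coordinate_bound[OF f(1)[of n], of i] f(2)[of n] norm_unit_pos[of i]
    by (simp add: norm_mult)
  obtain r where r: "strict_mono (r :: nat \<Rightarrow> nat)"
    and c: "\<And>i. i \<in> UNIV \<Longrightarrow> \<exists>a. (\<lambda>n. f (r n) i * of_real (N (indicator {i}))) \<longlonglongrightarrow> a"
    by (rule function_convergent_subsequence[where S = UNIV and M = 1
          and f = "\<lambda>n i. f n i * of_real (N (indicator {i}))"])
       (rule countableI_type, rule bound, blast)
  show thesis
  proof (rule that[OF r])
    fix i
    obtain a where "(\<lambda>n. f (r n) i * of_real (N (indicator {i}))) \<longlonglongrightarrow> a" using c by blast
    from tendsto_divide[OF this tendsto_const[of "of_real (N (indicator {i}))"]]
    show "convergent (\<lambda>n. f (r n) i)"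
      using norm_unit_pos[of i] by (auto simp: convergent_def)
  qed
qed

end

section \<open>Multipliers between two Koethe sequence spaces\<close>

locale kothe_sequence_space_pair =
  X: kothe_sequence_space M X NX + Y: kothe_sequence_space M Y NY
  for M :: "nat measure"
    and X Y :: "(nat \<Rightarrow> 'k::{real_normed_field, euclidean_space}) set"
    and NX NY :: "(nat \<Rightarrow> 'k) \<Rightarrow> real"
begin

lemma op_norm_upper:
  assumes T: "bounded_operator X NX Y NY T" and f: "f \<in> X" "NX f \<le> 1"
  shows "NY (T f) \<le> op_norm X NX NY T"
proof -
  obtain C where C: "\<And>f. f \<in> X \<Longrightarrow> NY (T f) \<le> C * NX f"
    using T unfolding bounded_operator_def by blast
  have "NY (T g) \<le> \<bar>C\<bar>" if "g \<in> X" "NX g \<le> 1" for g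
  proof -
    have "NY (T g) \<le> C * NX g" by (rule C[OF that(1)])
    also have "\<dots> \<le> \<bar>C\<bar> * 1"
      using that X.norm_nonneg[of g] by (intro mult_mono) auto
    finally show ?thesis by simp
  qed
  then show ?thesis
    unfolding op_norm_def using f
    by (intro cSUP_upper) (auto intro!: bdd_aboveI[of _ "\<bar>C\<bar>"])
qed

lemma op_norm_least:
  assumes "\<And>f. f \<in> X \<Longrightarrow> NX f \<le> 1 \<Longrightarrow> NY (T f) \<le> c"
  shows "op_norm X NX NY T \<le> c"
proof -
  have "(\<lambda>i. 0) \<in> {f \<in> X. NX f \<le> 1}" using X.zero_mem by simp
  then show ?thesis
    unfolding op_norm_def using assms by (intro cSUP_least) auto
qed

lemma op_norm_nonneg:
  assumes T: "bounded_operator X NX Y NY T"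
  shows "0 \<le> op_norm X NX NY T"
proof -
  have "T (\<lambda>i. 0) \<in> Y" using T X.zero_mem unfolding bounded_operator_def by blast
  then show ?thesis
    using op_norm_upper[OF T X.zero_mem] Y.norm_nonneg[of "T (\<lambda>i. 0)"] by simp
qed

lemma bounded_operator_diff:
  assumes S: "bounded_operator X NX Y NY S" and T: "bounded_operator X NX Y NY T"
  shows "bounded_operator X NX Y NY (\<lambda>f i. S f i - T f i)"
proof -
  have mem: "S f \<in> Y" "T f \<in> Y" if "f \<in> X" for f
    using S T that unfolding bounded_operator_def by blast+
  obtain C where C: "\<And>f. f \<in> X \<Longrightarrow> NY (S f) \<le> C * NX f"
    using S unfolding bounded_operator_def by blast
  obtain D where D: "\<And>f. f \<in> X \<Longrightarrow> NY (T f) \<le> D * NX f"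
    using T unfolding bounded_operator_def by blast
  have "NY (\<lambda>i. S f i - T f i) \<le> (C + D) * NX f" if "f \<in> X" for f
    using Y.norm_minus_triangle[OF mem[OF that]] C[OF that] D[OF that] by (simp add: algebra_simps)
  then have "\<exists>E. \<forall>f\<in>X. NY (\<lambda>i. S f i - T f i) \<le> E * NX f" by blast
  then show ?thesis
    using S T mem Y.diff_mem unfolding bounded_operator_def
    by (auto simp: fun_eq_iff algebra_simps image_subset_iff)
qed

lemma mult_op_mem: "l \<in> mult_space X Y \<Longrightarrow> f \<in> X \<Longrightarrow> mult_op l f \<in> Y"
  by (simp add: mult_space_def mult_op_def mult.commute)

lemma mult_norm_eq_op_norm: "mult_norm X NX NY l = op_norm X NX NY (mult_op l)"
  by (simp add: mult_norm_def op_norm_def mult_op_def mult.commute)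

text \<open>
  A gliding sum replaces the closed graph theorem. If \<open>f n\<close> in the unit ball had images of norm greater
  than \<open>4 ^ n\<close>, then the series of \<open>\<bar>f n\<bar> / 2 ^ n\<close> would converge in \<open>X\<close> to some \<open>g\<close> that dominates each
  summand, and the image of \<open>g\<close> would have norm at least \<open>4 ^ n / 2 ^ n = 2 ^ n\<close> for all \<open>n\<close>.
\<close>

lemma mult_op_bounded_on_ball:
  assumes l: "l \<in> mult_space X Y"
  obtains C where "\<And>f. f \<in> X \<Longrightarrow> NX f \<le> 1 \<Longrightarrow> NY (mult_op l f) \<le> C"
proof (rule ccontr)
  assume unbounded: "\<not> thesis"
  have "\<exists>f\<in>X. NX f \<le> 1 \<and> NY (mult_op l f) > 4 ^ n" for n :: nat
    using unbounded that by (meson not_le)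
  then obtain f where f: "\<And>n. f n \<in> X" "\<And>n. NX (f n) \<le> 1"
    and big: "\<And>n. NY (mult_op l (f n)) > 4 ^ n"
    by metis
  define u :: "nat \<Rightarrow> nat \<Rightarrow> 'k" where "u n = (\<lambda>i. of_real (norm (f n i) / 2 ^ n))" for n
  define s where "s n = (\<lambda>i. \<Sum>k<n. u k i)" for n
  have u: "u n \<in> X" "NX (u n) \<le> (1/2) ^ n" for n
  proof -
    have half: "(\<lambda>i. of_real ((1/2) ^ n) * f n i) \<in> X" by (rule X.scale_mem[OF f(1)])
    have le: "norm (u n i) \<le> norm (of_real ((1/2) ^ n) * f n i)" for i
      by (simp add: u_def norm_mult norm_power norm_divide power_divide)
    show "u n \<in> X" by (rule X.dominated_mem[OF half le])
    have "NX (u n) \<le> NX (\<lambda>i. of_real ((1/2) ^ n) * f n i)"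
      by (rule X.dominated_norm[OF half le])
    also have "\<dots> = (1/2) ^ n * NX (f n)"
      unfolding X.norm_scale[OF f(1)] by (simp add: norm_power norm_divide power_divide)
    also have "\<dots> \<le> (1/2) ^ n * 1" using f(2) by (intro mult_left_mono) auto
    finally show "NX (u n) \<le> (1/2) ^ n" by simp
  qed
  have s_mem: "s n \<in> X" for n
  proof (induction n)
    case 0
    then show ?case using X.zero_mem by (simp add: s_def)
  next
    case (Suc n)
    then show ?case using X.add_mem[OF Suc u(1)[of n]] by (simp add: s_def)
  qed
  have s_diff: "NX (\<lambda>i. s (m + k) i - s m i) \<le> 2 * (1/2) ^ m - 2 * (1/2) ^ (m + k)" for m k
  proof (induction k)
    case 0
    then show ?case by simp
  next
    case (Suc k)
    have "(\<lambda>i. s (m + Suc k) i - s m i) = (\<lambda>i. (s (m + k) i - s m i) + u (m + k) i)"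
      by (simp add: s_def algebra_simps)
    then have "NX (\<lambda>i. s (m + Suc k) i - s m i) \<le> NX (\<lambda>i. s (m + k) i - s m i) + NX (u (m + k))"
      using X.norm_triangle[OF X.diff_mem[OF s_mem s_mem] u(1)] by metis
    also have "\<dots> \<le> 2 * (1/2) ^ m - 2 * (1/2) ^ (m + k) + (1/2) ^ (m + k)"
      using Suc u(2)[of "m + k"] by linarith
    finally show ?case by simp
  qed
  have cauchy1: "NX (\<lambda>i. s n i - s m i) \<le> 2 * (1/2) ^ m" if "m \<le> n" for m n
  proof -
    obtain k where k: "n = m + k" using le_Suc_ex[OF \<open>m \<le> n\<close>] by blast
    have "0 \<le> (1/2::real) ^ (m + k)" by simp
    then show ?thesis using s_diff[of m k] unfolding k by linarith
  qed
  have cauchy2: "NX (\<lambda>i. s n i - s m i) \<le> 2 * (1/2) ^ (min m n)" for m n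
  proof (cases "m \<le> n")
    case False
    have "NX (\<lambda>i. s n i - s m i) \<le> NX (\<lambda>i. s m i - s n i)"
      by (rule X.dominated_norm[OF X.diff_mem[OF s_mem s_mem]]) (simp add: norm_minus_commute)
    with cauchy1[of n m] False show ?thesis by (simp add: min_def)
  qed (use cauchy1 in simp)
  have "\<exists>g\<in>X. (\<lambda>n. NX (\<lambda>x. s n x - g x)) \<longlonglongrightarrow> 0"
  proof (rule X.complete[OF s_mem], intro allI impI)
    fix e :: real assume e: "e > 0"
    have "(\<lambda>n. 2 * (1/2::real) ^ n) \<longlonglongrightarrow> 2 * 0"
      by (intro tendsto_mult tendsto_const LIMSEQ_power_zero) simp
    then have "\<forall>\<^sub>F n in sequentially. 2 * (1/2::real) ^ n < e"
      using e by (intro order_tendstoD(2)[where y = "2 * 0"]) auto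
    then obtain n0 where n0: "\<And>n. n \<ge> n0 \<Longrightarrow> 2 * (1/2::real) ^ n < e"
      by (auto simp: eventually_sequentially)
    show "\<exists>n0. \<forall>m\<ge>n0. \<forall>n\<ge>n0. NX (\<lambda>x. s m x - s n x) < e"
    proof (intro exI[of _ n0] allI impI)
      fix m n assume "n0 \<le> m" "n0 \<le> n"
      then have "2 * (1/2::real) ^ min n m < e" by (intro n0) simp
      then show "NX (\<lambda>x. s m x - s n x) < e" using cauchy2[of m n] by linarith
    qed
  qed
  then obtain g where g: "g \<in> X" "(\<lambda>n. NX (\<lambda>x. s n x - g x)) \<longlonglongrightarrow> 0" by blast
  \<comment> \<open>Norm convergence implies coordinatewise convergence, and the summands are nonnegative.\<close>
  have g_ge: "norm (f n i) / 2 ^ n \<le> norm (g i)" for n i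
  proof (rule tendsto_lowerbound)
    show "(\<lambda>m. norm (s m i)) \<longlonglongrightarrow> norm (g i)"
      by (rule tendsto_norm[OF X.norm_tendsto_imp_coordinate_tendsto[OF s_mem g]])
    have "norm (f n i) / 2 ^ n \<le> norm (s m i)" if "m > n" for m
    proof -
      have "s m i = of_real (\<Sum>k<m. norm (f k i) / 2 ^ k)"
        by (simp add: s_def u_def)
      then have "norm (s m i) = (\<Sum>k<m. norm (f k i) / 2 ^ k)"
        by (simp only: norm_of_real) (simp add: sum_nonneg)
      moreover have "norm (f n i) / 2 ^ n \<le> (\<Sum>k<m. norm (f k i) / 2 ^ k)"
        using that by (intro member_le_sum) auto
      ultimately show ?thesis by simp
    qed
    then show "\<forall>\<^sub>F m in sequentially. norm (f n i) / 2 ^ n \<le> norm (s m i)"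
      by (rule eventually_mono[OF eventually_gt_at_top])
  qed simp
  have "NY (mult_op l g) \<ge> 2 ^ n" for n
  proof -
    have "NY (\<lambda>i. of_real (1 / 2 ^ n) * mult_op l (f n) i) \<le> NY (mult_op l g)"
    proof (rule Y.dominated_norm[OF mult_op_mem[OF l g(1)]])
      fix i
      show "norm (of_real (1 / 2 ^ n) * mult_op l (f n) i) \<le> norm (mult_op l g i)"
        using mult_left_mono[OF g_ge[of n i], of "norm (l i)"]
        by (simp add: mult_op_def norm_mult norm_divide norm_power)
    qed
    moreover have "NY (\<lambda>i. of_real (1 / 2 ^ n) * mult_op l (f n) i) = NY (mult_op l (f n)) / 2 ^ n"
      unfolding Y.norm_scale[OF mult_op_mem[OF l f(1)]] by (simp add: norm_divide norm_power)
    moreover have "NY (mult_op l (f n)) / 2 ^ n \<ge> 4 ^ n / 2 ^ n"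
      using big[of n] by (intro divide_right_mono) auto
    moreover have "(4::real) ^ n / 2 ^ n = 2 ^ n"
      by (simp flip: power_divide)
    ultimately show ?thesis by simp
  qed
  then show False
    using real_arch_pow[of 2 "NY (mult_op l g)"] by (auto simp: not_le[symmetric])
qed

lemma bounded_operator_mult_op:
  assumes l: "l \<in> mult_space X Y"
  shows "bounded_operator X NX Y NY (mult_op l)"
proof -
  obtain C where C: "\<And>f. f \<in> X \<Longrightarrow> NX f \<le> 1 \<Longrightarrow> NY (mult_op l f) \<le> C"
    using mult_op_bounded_on_ball[OF l] by blast
  have "NY (mult_op l f) \<le> C * NX f" if f: "f \<in> X" for f
  proof (cases "NX f = 0")
    case True
    then have "mult_op l f = (\<lambda>i. 0)" using X.norm_eq_0[OF f] by (simp add: mult_op_def)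
    then show ?thesis using True by simp
  next
    case False
    then have pos: "NX f > 0" using X.norm_nonneg[OF f] by simp
    define h where "h = (\<lambda>i. of_real (1 / NX f) * f i)"
    have h: "h \<in> X" unfolding h_def by (rule X.scale_mem[OF f])
    have "NX h \<le> 1" unfolding h_def X.norm_scale[OF f] using pos by (simp add: norm_divide)
    have "mult_op l h = (\<lambda>i. of_real (1 / NX f) * mult_op l f i)"
      by (simp add: mult_op_def h_def mult_ac)
    then have "NY (mult_op l h) = NY (mult_op l f) / NX f"
      using Y.norm_scale[OF mult_op_mem[OF l f], of "of_real (1 / NX f)"] pos
      by (simp add: norm_divide)
    with C[OF h \<open>NX h \<le> 1\<close>] pos show ?thesis by (simp add: field_simps)
  qed
  then have "\<exists>C. \<forall>f\<in>X. NY (mult_op l f) \<le> C * NX f" by blast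
  then show ?thesis
    using mult_op_mem[OF l] unfolding bounded_operator_def
    by (auto simp: mult_op_def algebra_simps)
qed

lemma mult_norm_upper:
  "l \<in> mult_space X Y \<Longrightarrow> f \<in> X \<Longrightarrow> NX f \<le> 1 \<Longrightarrow> NY (mult_op l f) \<le> mult_norm X NX NY l"
  unfolding mult_norm_eq_op_norm by (rule op_norm_upper[OF bounded_operator_mult_op])

lemma mult_space_dominated:
  assumes "l \<in> mult_space X Y" "\<And>i. norm (h i) \<le> norm (l i)"
  shows "h \<in> mult_space X Y"
  unfolding mult_space_def
proof (intro CollectI ballI)
  fix f assume "f \<in> X"
  then have "(\<lambda>i. f i * l i) \<in> Y" using assms(1) by (simp add: mult_space_def)
  then show "(\<lambda>i. f i * h i) \<in> Y"
    by (rule Y.dominated_mem) (simp add: norm_mult mult_left_mono assms(2))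
qed

lemma mult_norm_dominated:
  assumes l: "l \<in> mult_space X Y" and le: "\<And>i. norm (h i) \<le> norm (l i)"
  shows "mult_norm X NX NY h \<le> mult_norm X NX NY l"
  unfolding mult_norm_eq_op_norm[of h]
proof (rule op_norm_least)
  fix f assume f: "f \<in> X" "NX f \<le> 1"
  have "NY (mult_op h f) \<le> NY (mult_op l f)"
    by (rule Y.dominated_norm[OF mult_op_mem[OF l f(1)]])
       (simp add: mult_op_def norm_mult mult_right_mono le)
  with mult_norm_upper[OF l f] show "NY (mult_op h f) \<le> mult_norm X NX NY l" by simp
qed

lemma mult_space_tail: "l \<in> mult_space X Y \<Longrightarrow> tail_seq n l \<in> mult_space X Y"
  by (erule mult_space_dominated) (simp add: tail_seq_def)

lemma mult_space_head: "l \<in> mult_space X Y \<Longrightarrow> head_seq n l \<in> mult_space X Y"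
  by (erule mult_space_dominated) (simp add: head_seq_def)

lemma mult_norm_nonneg: "l \<in> mult_space X Y \<Longrightarrow> 0 \<le> mult_norm X NX NY l"
  unfolding mult_norm_eq_op_norm by (rule op_norm_nonneg[OF bounded_operator_mult_op])

lemma mult_norm_tail_decseq:
  assumes "l \<in> mult_space X Y"
  shows "decseq (\<lambda>n. mult_norm X NX NY (tail_seq n l))"
proof (rule decseq_SucI)
  fix n
  show "mult_norm X NX NY (tail_seq (Suc n) l) \<le> mult_norm X NX NY (tail_seq n l)"
    by (rule mult_norm_dominated[OF mult_space_tail[OF assms]]) (simp add: tail_seq_def)
qed

lemma tail_mult_op: "tail_seq n (mult_op l f) = mult_op (tail_seq n l) f"
  by (auto simp: tail_seq_def mult_op_def)

text \<open>
  A sequence in the unit ball has a subsequence that converges in each coordinate. Its image under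
  \<open>mult_op l\<close> is a Cauchy sequence in norm: the tails are uniformly small by hypothesis, and the heads
  involve only finitely many coordinates. Completeness of \<open>Y\<close> then provides the limit.
\<close>

lemma compact_mult_op_if_tail_norms_tendsto_0:
  assumes l: "l \<in> mult_space X Y"
    and tails: "(\<lambda>n. mult_norm X NX NY (tail_seq n l)) \<longlonglongrightarrow> 0"
  shows "compact_operator X NX Y NY (mult_op l)"
  unfolding compact_operator_def
proof (intro conjI allI impI bounded_operator_mult_op l)
  fix F :: "nat \<Rightarrow> nat \<Rightarrow> 'k"
  assume F: "\<forall>n. F n \<in> X \<and> NX (F n) \<le> 1"
  then obtain r where r: "strict_mono r" and conv: "\<And>i. convergent (\<lambda>n. F (r n) i)"
    using X.coordinatewise_convergent_subsequence[of F] by blast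
  define G where "G n = mult_op l (F (r n))" for n
  have G: "G n \<in> Y" for n using F mult_op_mem[OF l] by (simp add: G_def)
  have "\<exists>g\<in>Y. (\<lambda>n. NY (\<lambda>y. G n y - g y)) \<longlonglongrightarrow> 0"
  proof (rule Y.complete[OF G], intro allI impI)
    fix e :: real assume e: "e > 0"
    obtain p where p: "mult_norm X NX NY (tail_seq p l) < e / 4"
      using order_tendstoD(2)[OF tails, of "e/4"] e by (auto simp: eventually_sequentially)
    have tail: "NY (tail_seq p (G n)) < e / 4" for n
      using mult_norm_upper[OF mult_space_tail[OF l], of "F (r n)" p] F p
      by (auto simp: G_def tail_mult_op intro: le_less_trans)
    \<comment> \<open>The summand 1 keeps \<open>c\<close> positive when \<open>p = 0\<close>, and makes the estimate of the head strict.\<close>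
    define c where "c = (\<Sum>i<p. NY (indicator {i})) + 1"
    have c: "c > 0" unfolding c_def
      by (intro add_nonneg_pos sum_nonneg less_imp_le[OF Y.norm_unit_pos]) simp
    have "\<exists>n0. \<forall>m\<ge>n0. \<forall>n\<ge>n0. norm (G m i - G n i) < e / (2 * c)" for i
    proof -
      have "convergent (\<lambda>n. G n i)"
        unfolding G_def mult_op_def by (intro convergent_mult convergent_const conv)
      then have "Cauchy (\<lambda>n. G n i)" by (rule convergent_Cauchy)
      then show ?thesis using c e unfolding Cauchy_iff by simp
    qed
    then obtain n0 where n0: "\<And>i m n. m \<ge> n0 i \<Longrightarrow> n \<ge> n0 i \<Longrightarrow> norm (G m i - G n i) < e / (2 * c)"
      by metis
    have "NY (\<lambda>y. G m y - G n y) < e" if mn: "m \<ge> Max (n0 ` {..p})" "n \<ge> Max (n0 ` {..p})" for m n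
    proof -
      have "NY (head_seq p (\<lambda>y. G m y - G n y)) \<le> (\<Sum>i<p. norm (G m i - G n i) * NY (indicator {i}))"
        by (rule Y.norm_head_le[OF Y.diff_mem[OF G G]])
      also have "\<dots> \<le> (\<Sum>i<p. e / (2 * c) * NY (indicator {i}))"
      proof (intro sum_mono mult_right_mono less_imp_le[OF n0] less_imp_le[OF Y.norm_unit_pos])
        fix i assume "i \<in> {..<p}"
        then have "n0 i \<le> Max (n0 ` {..p})" by (intro Max_ge) auto
        then show "n0 i \<le> m" "n0 i \<le> n"
          using mn(1) mn(2) order_trans by blast+
      qed
      also have "\<dots> = e / (2 * c) * (c - 1)" by (simp add: c_def sum_distrib_left)
      also have "\<dots> < e / 2" using c e by (simp add: field_simps)
      finally have head: "NY (head_seq p (\<lambda>y. G m y - G n y)) < e / 2" .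
      have "tail_seq p (\<lambda>y. G m y - G n y) = (\<lambda>y. tail_seq p (G m) y - tail_seq p (G n) y)"
        by (auto simp: tail_seq_def)
      then have "NY (tail_seq p (\<lambda>y. G m y - G n y)) \<le> NY (tail_seq p (G m)) + NY (tail_seq p (G n))"
        using Y.norm_minus_triangle[OF Y.tail_mem[OF G] Y.tail_mem[OF G]] by metis
      then show ?thesis
        using head tail[of m] tail[of n] Y.norm_le_head_add_tail[OF Y.diff_mem[OF G[of m] G[of n]], of p]
        by linarith
    qed
    then show "\<exists>n0. \<forall>m\<ge>n0. \<forall>n\<ge>n0. NY (\<lambda>y. G m y - G n y) < e" by blast
  qed
  then show "\<exists>g\<in>Y. \<exists>r. strict_mono r \<and> (\<lambda>n. NY (\<lambda>y. mult_op l (F (r n)) y - g y)) \<longlonglongrightarrow> 0"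
    using r unfolding G_def by blast
qed

lemma compact_mult_op_head:
  assumes l: "l \<in> mult_space X Y"
  shows "compact_operator X NX Y NY (mult_op (head_seq n l))"
proof (rule compact_mult_op_if_tail_norms_tendsto_0[OF mult_space_head[OF l]])
  have "mult_norm X NX NY (tail_seq m (head_seq n l)) = 0" if "m \<ge> n" for m
  proof -
    have "tail_seq m (head_seq n l) = (\<lambda>i. 0)"
      using that by (auto simp: tail_seq_def head_seq_def)
    moreover have "mult_norm X NX NY (\<lambda>i. 0) \<le> 0"
      unfolding mult_norm_eq_op_norm by (rule op_norm_least) (simp add: mult_op_def)
    ultimately show ?thesis
      using mult_norm_nonneg[OF mult_space_tail[OF mult_space_head[OF l]], of m n] by simp
  qed
  then show "(\<lambda>m. mult_norm X NX NY (tail_seq m (head_seq n l))) \<longlonglongrightarrow> 0"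
    by (intro tendsto_eventually) (auto simp: eventually_sequentially)
qed

lemma ess_norm_lower:
  assumes T: "bounded_operator X NX Y NY T" and K: "compact_operator X NX Y NY K"
  shows "ess_norm X NX Y NY T \<le> op_norm X NX NY (\<lambda>f y. T f y - K f y)"
  unfolding ess_norm_def
proof (rule cINF_lower)
  show "bdd_below ((\<lambda>K. op_norm X NX NY (\<lambda>f y. T f y - K f y)) ` {K. compact_operator X NX Y NY K})"
    using T by (intro bdd_belowI[of _ 0])
      (auto simp: compact_operator_def intro!: op_norm_nonneg bounded_operator_diff)
qed (use K in simp)

lemma ess_norm_le_tail_norm:
  assumes l: "l \<in> mult_space X Y"
  shows "ess_norm X NX Y NY (mult_op l) \<le> mult_norm X NX NY (tail_seq n l)"
proof -
  have "(\<lambda>f i. mult_op l f i - mult_op (head_seq n l) f i) = mult_op (tail_seq n l)"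
    by (auto simp: fun_eq_iff mult_op_def head_seq_def tail_seq_def)
  then show ?thesis
    using ess_norm_lower[OF bounded_operator_mult_op[OF l] compact_mult_op_head[OF l]]
    unfolding mult_norm_eq_op_norm by metis
qed

text \<open>
  The lower estimate of the essential norm, relative to the hypothesis \<open>tails\<close>. That hypothesis
  isolates the only place where reflexivity or separability enters, so that both cases share this
  argument. The functions \<open>F k\<close> are almost extremal for the multiplier \<open>tail_seq k l\<close> and may be cut down
  to the indices from \<open>k\<close> on, since this changes neither the product nor membership in the ball.
\<close>

lemma tail_norm_limit_le_op_norm_diff:
  assumes l: "l \<in> mult_space X Y" and K: "compact_operator X NX Y NY K"
    and L: "(\<lambda>n. mult_norm X NX NY (tail_seq n l)) \<longlonglongrightarrow> L"
    and tails: "\<And>F g. (\<And>k. F k \<in> X) \<Longrightarrow> (\<And>k. NX (F k) \<le> 1) \<Longrightarrow>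
      (\<And>i. (\<lambda>k. F k i) \<longlonglongrightarrow> 0) \<Longrightarrow> g \<in> Y \<Longrightarrow>
      (\<lambda>k. NY (\<lambda>i. K (F k) i - g i)) \<longlonglongrightarrow> 0 \<Longrightarrow> (\<lambda>k. NY (tail_seq k g)) \<longlonglongrightarrow> 0"
  shows "L \<le> op_norm X NX NY (\<lambda>f i. mult_op l f i - K f i)"
proof -
  define q where "q n = mult_norm X NX NY (tail_seq n l)" for n
  define D where "D = (\<lambda>f i. mult_op l f i - K f i)"
  have Kb: "bounded_operator X NX Y NY K" using K by (simp add: compact_operator_def)
  then have Kmem: "K f \<in> Y" if "f \<in> X" for f
    using that unfolding bounded_operator_def by blast
  have D: "bounded_operator X NX Y NY D"
    unfolding D_def by (rule bounded_operator_diff[OF bounded_operator_mult_op[OF l] Kb])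
  have "\<exists>f\<in>X. NX f \<le> 1 \<and> NY (mult_op (tail_seq k l) f) > q k - 1 / Suc k" for k
  proof (rule ccontr)
    assume "\<not> ?thesis"
    then have "q k \<le> q k - 1 / Suc k"
      unfolding q_def mult_norm_eq_op_norm by (intro op_norm_least) (auto simp: not_less)
    then show False by simp
  qed
  then obtain f where f: "\<And>k. f k \<in> X" "\<And>k. NX (f k) \<le> 1"
    and near: "\<And>k. NY (mult_op (tail_seq k l) (f k)) > q k - 1 / Suc k"
    by metis
  define F where "F k = tail_seq k (f k)" for k
  have F: "F k \<in> X" "NX (F k) \<le> 1" for k
    using X.tail_mem[OF f(1)] X.norm_tail_le[OF f(1)[of k], of k] f(2)[of k]
    by (auto simp: F_def)
  have F0: "(\<lambda>k. F k i) \<longlonglongrightarrow> 0" for i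
  proof (rule tendsto_eventually)
    show "\<forall>\<^sub>F k in sequentially. F k i = 0"
      using eventually_gt_at_top[of i] by eventually_elim (simp add: F_def tail_seq_def)
  qed
  obtain g r where g: "g \<in> Y" and r: "strict_mono r"
    and Kg: "(\<lambda>k. NY (\<lambda>i. K (F (r k)) i - g i)) \<longlonglongrightarrow> 0"
    using K F unfolding compact_operator_def by blast
  have g_tails: "(\<lambda>k. NY (tail_seq k g)) \<longlonglongrightarrow> 0"
    by (rule tails[of "\<lambda>k. F (r k)", OF F(1) F(2) _ g Kg])
       (use LIMSEQ_subseq_LIMSEQ[OF F0 r] in \<open>simp add: o_def\<close>)
  have bound: "q (r k) - 1 / Suc (r k) - NY (\<lambda>i. K (F (r k)) i - g i) - NY (tail_seq (r k) g)
      \<le> op_norm X NX NY D" for k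
  proof -
    define n where "n = r k"
    have DF: "D (F n) \<in> Y" using D F(1) unfolding bounded_operator_def by blast
    have Kd: "(\<lambda>i. K (F n) i - g i) \<in> Y" by (rule Y.diff_mem[OF Kmem[OF F(1)] g])
    have split: "mult_op (tail_seq n l) (f n)
        = (\<lambda>i. (tail_seq n (D (F n)) i + tail_seq n (\<lambda>i. K (F n) i - g i) i) + tail_seq n g i)"
      by (auto simp: D_def F_def tail_seq_def mult_op_def)
    have "NY (mult_op (tail_seq n l) (f n))
        \<le> NY (\<lambda>i. tail_seq n (D (F n)) i + tail_seq n (\<lambda>i. K (F n) i - g i) i) + NY (tail_seq n g)"
      unfolding split by (intro Y.norm_triangle Y.add_mem Y.tail_mem DF Kd g)
    also have "\<dots> \<le> (NY (tail_seq n (D (F n))) + NY (tail_seq n (\<lambda>i. K (F n) i - g i)))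
        + NY (tail_seq n g)"
      by (intro add_right_mono Y.norm_triangle Y.tail_mem DF Kd)
    finally have "NY (mult_op (tail_seq n l) (f n))
        \<le> NY (D (F n)) + NY (\<lambda>i. K (F n) i - g i) + NY (tail_seq n g)"
      using Y.norm_tail_le[OF DF, of n] Y.norm_tail_le[OF Kd, of n] by linarith
    then show ?thesis
      using near[of n] op_norm_upper[OF D F, of n] unfolding n_def by linarith
  qed
  have "(\<lambda>k. q (r k) - 1 / Suc (r k) - NY (\<lambda>i. K (F (r k)) i - g i) - NY (tail_seq (r k) g))
      \<longlonglongrightarrow> L - 0 - 0 - 0"
  proof (intro tendsto_diff Kg)
    show "(\<lambda>k. q (r k)) \<longlonglongrightarrow> L"
      using LIMSEQ_subseq_LIMSEQ[OF L r] by (simp add: o_def q_def)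
    show "(\<lambda>k. 1 / real (Suc (r k))) \<longlonglongrightarrow> 0"
      using LIMSEQ_subseq_LIMSEQ[OF LIMSEQ_inverse_real_of_nat r] by (simp add: o_def inverse_eq_divide)
    show "(\<lambda>k. NY (tail_seq (r k) g)) \<longlonglongrightarrow> 0"
      using LIMSEQ_subseq_LIMSEQ[OF g_tails r] by (simp add: o_def)
  qed
  then have "L - 0 - 0 - 0 \<le> op_norm X NX NY D"
    by (rule LIMSEQ_le_const2) (use bound in blast)
  then show ?thesis by (simp add: D_def)
qed

text \<open>
  For separable \<open>Y\<close> this holds for every \<open>g\<close>. For reflexive \<open>X\<close> the coordinate functionals of \<open>Y\<close> composed
  with \<open>K\<close> are bounded functionals on \<open>X\<close>, which send \<open>F k\<close> to a null sequence, and thus \<open>g = 0\<close>.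
\<close>

lemma tail_tendsto_0_if_reflexive_or_separable:
  assumes fatou: "fatou_property M Y NY"
    and alt: "reflexive_space X NX \<or> norm_separable Y NY"
    and K: "bounded_operator X NX Y NY K"
    and F: "\<And>k. F k \<in> X" "\<And>k. NX (F k) \<le> 1" "\<And>i. (\<lambda>k. F k i) \<longlonglongrightarrow> 0"
    and g: "g \<in> Y" "(\<lambda>k. NY (\<lambda>i. K (F k) i - g i)) \<longlonglongrightarrow> 0"
  shows "(\<lambda>k. NY (tail_seq k g)) \<longlonglongrightarrow> 0"
  using alt
proof
  assume "norm_separable Y NY"
  then show ?thesis by (rule Y.separable_norm_tail_tendsto_0[OF fatou _ g(1)])
next
  assume refl: "reflexive_space X NX"
  have Kmem: "K f \<in> Y" if "f \<in> X" for f
    using that K unfolding bounded_operator_def by blast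
  have "g i = 0" for i
  proof -
    define \<phi> where "\<phi> = (\<lambda>f. if f \<in> X then K f i else 0)"
    obtain C where C: "\<And>f. f \<in> X \<Longrightarrow> NY (K f) \<le> C * NX f"
      using K unfolding bounded_operator_def by blast
    have "norm (\<phi> f) \<le> C / NY (indicator {i}) * NX f" if "f \<in> X" for f
      using Y.coordinate_bound[OF Kmem[OF that], of i] C[OF that] Y.norm_unit_pos[of i] that
      by (simp add: \<phi>_def field_simps)
    then have "\<exists>C. \<forall>f\<in>X. norm (\<phi> f) \<le> C * NX f" by blast
    then have "\<phi> \<in> dual_space X NX"
      using K unfolding dual_space_def bounded_operator_def
      by (auto simp: \<phi>_def X.add_mem X.scale_mem)
    moreover have "(\<lambda>k. \<phi> (F k)) \<longlonglongrightarrow> g i"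
      using Y.norm_tendsto_imp_coordinate_tendsto[of "\<lambda>k. K (F k)", OF Kmem[OF F(1)] g] F(1)
      by (simp add: \<phi>_def)
    ultimately show ?thesis
      by (rule X.reflexive_functional_limit_0[OF refl F])
  qed
  then have "tail_seq k g = (\<lambda>i. 0)" for k by (auto simp: tail_seq_def)
  then show ?thesis by simp
qed

lemma tail_norm_tendsto_ess_norm:
  assumes fatou: "fatou_property M Y NY"
    and alt: "reflexive_space X NX \<or> norm_separable Y NY"
    and l: "l \<in> mult_space X Y"
  shows "(\<lambda>n. mult_norm X NX NY (tail_seq n l)) \<longlonglongrightarrow> ess_norm X NX Y NY (mult_op l)"
proof -
  obtain L where L: "(\<lambda>n. mult_norm X NX NY (tail_seq n l)) \<longlonglongrightarrow> L"
    using decseq_convergent[OF mult_norm_tail_decseq[OF l], of 0]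
      mult_norm_nonneg[OF mult_space_tail[OF l]] by blast
  have "ess_norm X NX Y NY (mult_op l) \<le> L"
    by (rule LIMSEQ_le_const[OF L]) (use ess_norm_le_tail_norm[OF l] in blast)
  moreover have "L \<le> ess_norm X NX Y NY (mult_op l)"
    unfolding ess_norm_def
  proof (rule cINF_greatest)
    show "{K. compact_operator X NX Y NY K} \<noteq> {}"
      using compact_mult_op_head[OF l] by blast
    fix K assume "K \<in> {K. compact_operator X NX Y NY K}"
    then have K: "compact_operator X NX Y NY K" by simp
    then have Kb: "bounded_operator X NX Y NY K" by (simp add: compact_operator_def)
    show "L \<le> op_norm X NX NY (\<lambda>f y. mult_op l f y - K f y)"
      by (rule tail_norm_limit_le_op_norm_diff[OF l K L
            tail_tendsto_0_if_reflexive_or_separable[OF fatou alt Kb]])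
  qed
  ultimately show ?thesis using L by simp
qed

text \<open>
  One direction tests order continuity on the moduli of the tails of \<open>l\<close>. For the other one, split a
  sequence that decreases to zero below the modulus of \<open>l\<close> at an index \<open>p\<close>. The tail is dominated by
  the tail of \<open>l\<close>, and the head is a sum over finitely many indices that tends to zero coordinatewise.
\<close>

lemma order_continuous_part_iff_tail_norms_tendsto_0:
  assumes l: "l \<in> mult_space X Y"
  shows "l \<in> order_continuous_part M (mult_space X Y) (mult_norm X NX NY) \<longleftrightarrow>
         (\<lambda>n. mult_norm X NX NY (tail_seq n l)) \<longlonglongrightarrow> 0"
proof
  assume oc: "l \<in> order_continuous_part M (mult_space X Y) (mult_norm X NX NY)"
  define h where "h n i = norm (tail_seq n l i)" for n i
  have h_mem: "(\<lambda>i. of_real (h n i)) \<in> mult_space X Y" for n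
    by (rule mult_space_dominated[OF l]) (simp add: h_def tail_seq_def)
  have "0 \<le> h n i \<and> h n i \<le> norm (l i)" for n i
    by (simp add: h_def tail_seq_def)
  moreover have "decseq (\<lambda>n. h n i)" for i
    by (auto simp: decseq_def h_def tail_seq_def)
  moreover have "(\<lambda>n. h n i) \<longlonglongrightarrow> 0" for i
  proof (rule tendsto_eventually)
    show "\<forall>\<^sub>F k in sequentially. h k i = 0"
      using eventually_gt_at_top[of i] by eventually_elim (simp add: h_def tail_seq_def)
  qed
  ultimately have lim: "(\<lambda>n. mult_norm X NX NY (\<lambda>i. of_real (h n i))) \<longlonglongrightarrow> 0"
    using oc h_mem unfolding order_continuous_part_def by simp
  show "(\<lambda>n. mult_norm X NX NY (tail_seq n l)) \<longlonglongrightarrow> 0"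
  proof (rule tendsto_sandwich[OF _ _ tendsto_const lim])
    show "\<forall>\<^sub>F n in sequentially. 0 \<le> mult_norm X NX NY (tail_seq n l)"
      by (simp add: mult_norm_nonneg mult_space_tail l)
    show "\<forall>\<^sub>F n in sequentially.
        mult_norm X NX NY (tail_seq n l) \<le> mult_norm X NX NY (\<lambda>i. of_real (h n i))"
      by (intro always_eventually allI mult_norm_dominated[OF h_mem]) (simp add: h_def)
  qed
next
  assume tails: "(\<lambda>n. mult_norm X NX NY (tail_seq n l)) \<longlonglongrightarrow> 0"
  show "l \<in> order_continuous_part M (mult_space X Y) (mult_norm X NX NY)"
    unfolding order_continuous_part_def
  proof (intro CollectI conjI l allI impI)
    fix h :: "nat \<Rightarrow> nat \<Rightarrow> real"
    assume h_mem: "\<forall>n. (\<lambda>x. of_real (h n x)) \<in> mult_space X Y"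
      and "\<forall>n. \<forall>x\<in>space M. 0 \<le> h n x \<and> h n x \<le> norm (l x)"
      and "\<forall>x\<in>space M. decseq (\<lambda>n. h n x) \<and> (\<lambda>n. h n x) \<longlonglongrightarrow> 0"
    then have h: "\<And>n i. 0 \<le> h n i" "\<And>n i. h n i \<le> norm (l i)" and h0: "\<And>i. (\<lambda>n. h n i) \<longlonglongrightarrow> 0"
      by (auto simp: X.space_eq)
    have bound: "mult_norm X NX NY (\<lambda>i. of_real (h n i))
        \<le> (\<Sum>i<p. h n i * (1 / NX (indicator {i})) * NY (indicator {i}))
          + mult_norm X NX NY (tail_seq p l)" for n p
      unfolding mult_norm_eq_op_norm[of "\<lambda>i. of_real (h n i)"]
    proof (rule op_norm_least)
      fix f assume f: "f \<in> X" "NX f \<le> 1"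
      let ?y = "mult_op (\<lambda>i. of_real (h n i)) f"
      have y: "?y \<in> Y" using h_mem mult_op_mem f by blast
      have "NY (head_seq p ?y) \<le> (\<Sum>i<p. norm (?y i) * NY (indicator {i}))"
        by (rule Y.norm_head_le[OF y])
      also have "\<dots> \<le> (\<Sum>i<p. h n i * (1 / NX (indicator {i})) * NY (indicator {i}))"
      proof (intro sum_mono mult_right_mono less_imp_le[OF Y.norm_unit_pos])
        fix i
        have "norm (f i) \<le> 1 / NX (indicator {i})"
          using X.coordinate_bound[OF f(1), of i] f(2) X.norm_unit_pos[of i] by (simp add: field_simps)
        then have "h n i * norm (f i) \<le> h n i * (1 / NX (indicator {i}))"
          by (rule mult_left_mono[OF _ h(1)])
        then show "norm (?y i) \<le> h n i * (1 / NX (indicator {i}))"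
          using h(1)[of n i] by (simp add: mult_op_def norm_mult)
      qed
      finally have head: "NY (head_seq p ?y)
          \<le> (\<Sum>i<p. h n i * (1 / NX (indicator {i})) * NY (indicator {i}))" .
      have "NY (tail_seq p ?y) \<le> NY (mult_op (tail_seq p l) f)"
        using h by (intro Y.dominated_norm mult_op_mem mult_space_tail l f)
          (auto simp: tail_seq_def mult_op_def norm_mult intro!: mult_right_mono)
      also have "\<dots> \<le> mult_norm X NX NY (tail_seq p l)"
        by (rule mult_norm_upper[OF mult_space_tail[OF l] f])
      finally show "NY ?y \<le> (\<Sum>i<p. h n i * (1 / NX (indicator {i})) * NY (indicator {i}))
          + mult_norm X NX NY (tail_seq p l)"
        using head Y.norm_le_head_add_tail[OF y, of p] by linarith
    qed
    show "(\<lambda>n. mult_norm X NX NY (\<lambda>x. of_real (h n x))) \<longlonglongrightarrow> 0"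
    proof (rule order_tendstoI)
      fix a :: real assume "a < 0"
      moreover have "0 \<le> mult_norm X NX NY (\<lambda>x. of_real (h n x))" for n
        using h_mem mult_norm_nonneg by blast
      ultimately show "\<forall>\<^sub>F n in sequentially. a < mult_norm X NX NY (\<lambda>x. of_real (h n x))"
        by (intro always_eventually allI) (rule less_le_trans)
    next
      fix a :: real assume a: "0 < a"
      obtain p where p: "mult_norm X NX NY (tail_seq p l) < a / 2"
        using order_tendstoD(2)[OF tails, of "a/2"] a by (auto simp: eventually_sequentially)
      have "(\<lambda>n. \<Sum>i<p. h n i * (1 / NX (indicator {i})) * NY (indicator {i})) \<longlonglongrightarrow> 0"
        by (intro tendsto_null_sum tendsto_mult_left_zero h0)
      then have "\<forall>\<^sub>F n in sequentially.
          (\<Sum>i<p. h n i * (1 / NX (indicator {i})) * NY (indicator {i})) < a / 2"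
        using a by (intro order_tendstoD(2)) auto
      then show "\<forall>\<^sub>F n in sequentially. mult_norm X NX NY (\<lambda>x. of_real (h n x)) < a"
      proof eventually_elim
        case (elim n)
        then show ?case using bound[of n p] p by linarith
      qed
    qed
  qed
qed

lemma ess_norm_compact:
  assumes K: "compact_operator X NX Y NY K"
  shows "ess_norm X NX Y NY K \<le> 0"
proof -
  have "op_norm X NX NY (\<lambda>f y. K f y - K f y) \<le> 0"
    by (rule op_norm_least) simp
  then show ?thesis
    using ess_norm_lower[of K K] K by (simp add: compact_operator_def)
qed

end

theorem theorem4p3:
  fixes M :: "nat measure"
    and X Y :: "(nat \<Rightarrow> 'k::{real_normed_field, euclidean_space}) set"
    and NX NY :: "(nat \<Rightarrow> 'k) \<Rightarrow> real"
    and l :: "nat \<Rightarrow> 'k"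
  assumes "kothe_sequence_space M X NX" and "kothe_sequence_space M Y NY"
    and "fatou_property M X NX" and "fatou_property M Y NY"
    and "reflexive_space X NX \<or> norm_separable Y NY"
    and "l \<in> mult_space X Y"
  shows "(\<lambda>n. mult_norm X NX NY (tail_seq n l)) \<longlonglongrightarrow> ess_norm X NX Y NY (mult_op l) \<and>
         (compact_operator X NX Y NY (mult_op l) \<longleftrightarrow>
          l \<in> order_continuous_part M (mult_space X Y) (mult_norm X NX NY))"
proof -
  interpret kothe_sequence_space_pair M X Y NX NY
    using assms(1,2) by (rule kothe_sequence_space_pair.intro)
  note l = assms(6)
  have lim: "(\<lambda>n. mult_norm X NX NY (tail_seq n l)) \<longlonglongrightarrow> ess_norm X NX Y NY (mult_op l)"
    by (rule tail_norm_tendsto_ess_norm[OF assms(4,5) l])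
  have "compact_operator X NX Y NY (mult_op l) \<longleftrightarrow>
      (\<lambda>n. mult_norm X NX NY (tail_seq n l)) \<longlonglongrightarrow> 0"
  proof
    assume "compact_operator X NX Y NY (mult_op l)"
    then have "ess_norm X NX Y NY (mult_op l) \<le> 0" by (rule ess_norm_compact)
    moreover have "0 \<le> ess_norm X NX Y NY (mult_op l)"
      by (rule LIMSEQ_le_const[OF lim]) (use mult_norm_nonneg[OF mult_space_tail[OF l]] in blast)
    ultimately show "(\<lambda>n. mult_norm X NX NY (tail_seq n l)) \<longlonglongrightarrow> 0"
      using lim by simp
  qed (rule compact_mult_op_if_tail_norms_tendsto_0[OF l])
  then show ?thesis
    using lim order_continuous_part_iff_tail_norms_tendsto_0[OF l] by simp
qed

end
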